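(* Let $\alpha\in\mathbb{R}$, $v\in L^2_{\mathbb{C}}(0,1)$, and let $z\in\mathbb{C}$ with $z\notin\sigma(L_0)\cup\sigma(L_\alpha)$. Then the resolvent $R_{L_\alpha}(z)=(L_\alpha-zI)^{-1}$ is expressed through the resolvent $R_{L_0}(z)=(L_0-zI)^{-1}$ by: for every $f\in L^2_{\mathbb{C}}(0,1)$, $$R_{L_\alpha}(z)f=R_{L_0}(z)f-\alpha\frac{\langle R_{L_0}(z)f,v\rangle}{1+\alpha\langle R_{L_0}(z)v,v\rangle}\,R_{L_0}(z)v =\sum_{n\in\mathbb{Z}}\frac{f_n}{z_n-z}u_n-\alpha\,\frac{\sum_{k\in\mathbb{Z}}\frac{f_k\overline{v_k}}{z_k-z}}{1+\alpha\sum_{k\in\mathbb{Z}}\frac{|v_k|^2}{z_k-z}}\sum_{n\in\mathbb{Z}}\frac{v_n}{z_n-z}u_n .$$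
   Context: $\langle f,g\rangle=\int_0^1 f(x)\overline{g(x)}\,dx$ on $L^2_{\mathbb{C}}(0,1)$. The operator $L_\alpha=L_\alpha(v)$ is $(L_\alpha y)(x)=\mathrm{i}y'''(x)+\alpha\langle y,v\rangle v(x)$ with domain $\{y\in W_3^2(0,1): y(1)=y(0),\ y'(1)=y'(0),\ y''(1)=y''(0)\}$, where $W_3^2(0,1)$ is the Sobolev space of functions with three derivatives in $L^2$; $L_0$ is the operator with $\alpha=0$. $\sigma(\cdot)$ denotes the spectrum. For $n\in\mathbb{Z}$: $z_n=(2n\pi)^3$ and $u_n(x)=\mathrm{e}^{2n\pi\mathrm{i}x}$ are the eigenvalues and eigenfunctions of $L_0$; $f_n=\langle f,u_n\rangle$, $v_n=\langle v,u_n\rangle$. *)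

theory Defs
  imports "HOL-Analysis.Analysis"
begin

section \<open>The Hilbert space of square-integrable complex functions on (0,1)\<close>

abbreviation leb01 :: "real measure" where
  "leb01 \<equiv> lebesgue_on {0<..<1}"

definition sq_integrable :: "(real \<Rightarrow> complex) \<Rightarrow> bool" where
  "sq_integrable f \<longleftrightarrow>
     f \<in> borel_measurable leb01 \<and> integrable leb01 (\<lambda>x. (cmod (f x))\<^sup>2)"

lemma Re_mult_cnj: "Re (w * cnj w) = (cmod w)\<^sup>2"
  unfolding cmod_power2 by (simp add: power2_eq_square)

lemma sq_integrable_0: "sq_integrable (\<lambda>x. 0)"
  by (simp add: sq_integrable_def)

lemma sq_integrable_mult:
  assumes "sq_integrable f" "sq_integrable g"
  shows "integrable leb01 (\<lambda>x. f x * cnj (g x))"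
proof (rule Bochner_Integration.integrable_bound)
  show "integrable leb01 (\<lambda>x. (cmod (f x))\<^sup>2 + (cmod (g x))\<^sup>2)"
    using assms by (auto simp: sq_integrable_def)
  have [measurable]: "f \<in> borel_measurable leb01" "g \<in> borel_measurable leb01"
    using assms by (auto simp: sq_integrable_def)
  show "(\<lambda>x. f x * cnj (g x)) \<in> borel_measurable leb01"
    by (intro borel_measurable_times borel_measurable_continuous_on[of cnj])
      (auto intro: continuous_intros)
  show "AE x in leb01. norm (f x * cnj (g x)) \<le> norm ((cmod (f x))\<^sup>2 + (cmod (g x))\<^sup>2)"
  proof (intro always_eventually allI)
    fix x
    have "0 \<le> (cmod (f x) - cmod (g x))\<^sup>2" "0 \<le> cmod (f x) * cmod (g x)" by auto
    then have "cmod (f x) * cmod (g x) \<le> (cmod (f x))\<^sup>2 + (cmod (g x))\<^sup>2"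
      unfolding power2_diff by linarith
    then show "norm (f x * cnj (g x)) \<le> norm ((cmod (f x))\<^sup>2 + (cmod (g x))\<^sup>2)"
      by (simp add: norm_mult)
  qed
qed

lemma sq_integrable_add:
  assumes "sq_integrable f" "sq_integrable g"
  shows "sq_integrable (\<lambda>x. f x + g x)"
proof -
  have "integrable leb01 (\<lambda>x. (f x + g x) * cnj (f x + g x))"
  proof -
    have "(\<lambda>x. (f x + g x) * cnj (f x + g x)) =
      (\<lambda>x. f x * cnj (f x) + f x * cnj (g x) + g x * cnj (f x) + g x * cnj (g x))"
      by (auto simp: algebra_simps)
    then show ?thesis
      by (simp add: sq_integrable_mult assms)
  qed
  then have "integrable leb01 (\<lambda>x. Re ((f x + g x) * cnj (f x + g x)))"
    by (rule integrable_Re)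
  then show ?thesis
    using assms unfolding Re_mult_cnj by (auto simp: sq_integrable_def)
qed

lemma sq_integrable_scale:
  assumes "sq_integrable f"
  shows "sq_integrable (\<lambda>x. c * f x)"
  using assms by (auto simp: sq_integrable_def norm_mult power_mult_distrib)

lemma sq_integrable_scaleR:
  assumes "sq_integrable f"
  shows "sq_integrable (\<lambda>x. r *\<^sub>R f x)"
  using sq_integrable_scale[OF assms, of "complex_of_real r"] by (simp add: scaleR_conv_of_real)

lemma sq_integrable_uminus:
  assumes "sq_integrable f"
  shows "sq_integrable (\<lambda>x. - f x)"
  using sq_integrable_scale[OF assms, of "-1"] by simp

lemma sq_integrable_diff:
  assumes "sq_integrable f" "sq_integrable g"
  shows "sq_integrable (\<lambda>x. f x - g x)"
  using sq_integrable_add[OF assms(1) sq_integrable_uminus[OF assms(2)]] by simp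

definition l2_rel :: "(real \<Rightarrow> complex) \<Rightarrow> (real \<Rightarrow> complex) \<Rightarrow> bool" where
  "l2_rel f g \<longleftrightarrow> sq_integrable f \<and> sq_integrable g \<and> (AE x in leb01. f x = g x)"

text \<open>For square-integrable \<^term>\<open>f\<close>, the term \<open>abs_l2 f\<close> is the class of \<^term>\<open>f\<close>;
  for other functions \<open>abs_l2 f\<close> is unspecified.\<close>

quotient_type l2 = "real \<Rightarrow> complex" / partial: l2_rel
proof (rule part_equivpI)
  show "\<exists>f. l2_rel f f"
    using sq_integrable_0 by (auto simp: l2_rel_def)
  show "symp l2_rel"
    by (auto simp: symp_def l2_rel_def elim: eventually_mono)
  show "transp l2_rel"
  proof (rule transpI)
    fix f g h assume "l2_rel f g" "l2_rel g h"
    then show "l2_rel f h"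
      unfolding l2_rel_def by (auto elim: eventually_elim2)
  qed
qed

lift_definition scaleC :: "complex \<Rightarrow> l2 \<Rightarrow> l2" (infixr \<open>*\<^sub>C\<close> 75) is "\<lambda>c f x. c * f x"
  by (auto simp: l2_rel_def sq_integrable_scale elim: eventually_mono)

lift_definition cinner :: "l2 \<Rightarrow> l2 \<Rightarrow> complex" (\<open>\<langle>_, _\<rangle>\<close>)
  is "\<lambda>f g. integral\<^sup>L leb01 (\<lambda>x. f x * cnj (g x))"
proof -
  fix f f' g g' assume *: "l2_rel f f'" "l2_rel g g'"
  show "(LINT x|leb01. f x * cnj (g x)) = (LINT x|leb01. f' x * cnj (g' x))"
  proof (rule integral_cong_AE)
    show "(\<lambda>x. f x * cnj (g x)) \<in> borel_measurable leb01"
      "(\<lambda>x. f' x * cnj (g' x)) \<in> borel_measurable leb01"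
      using * by (auto simp: l2_rel_def intro!: borel_measurable_integrable sq_integrable_mult)
    show "AE x in leb01. f x * cnj (g x) = f' x * cnj (g' x)"
      using * unfolding l2_rel_def by (auto elim: eventually_elim2)
  qed
qed

instantiation l2 :: real_vector
begin

lift_definition zero_l2 :: l2 is "\<lambda>x. 0"
  by (simp add: l2_rel_def sq_integrable_0)

lift_definition plus_l2 :: "l2 \<Rightarrow> l2 \<Rightarrow> l2" is "\<lambda>f g x. f x + g x"
  by (auto simp: l2_rel_def sq_integrable_add elim: eventually_elim2)

lift_definition minus_l2 :: "l2 \<Rightarrow> l2 \<Rightarrow> l2" is "\<lambda>f g x. f x - g x"
  by (auto simp: l2_rel_def sq_integrable_diff elim: eventually_elim2)

lift_definition uminus_l2 :: "l2 \<Rightarrow> l2" is "\<lambda>f x. - f x"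
  by (auto simp: l2_rel_def sq_integrable_uminus elim: eventually_mono)

lift_definition scaleR_l2 :: "real \<Rightarrow> l2 \<Rightarrow> l2" is "\<lambda>r f x. r *\<^sub>R f x"
  by (auto simp: l2_rel_def sq_integrable_scaleR elim: eventually_mono)

instance
proof
  fix f g h :: l2 and r s :: real
  show "f + g + h = f + (g + h)"
    by transfer (auto simp: l2_rel_def sq_integrable_add add.assoc)
  show "f + g = g + f"
    by transfer (auto simp: l2_rel_def sq_integrable_add add.commute)
  show "0 + f = f"
    by transfer (auto simp: l2_rel_def)
  show "- f + f = 0"
    by transfer (auto simp: l2_rel_def sq_integrable_0)
  show "f - g = f + - g"
    by transfer (auto simp: l2_rel_def sq_integrable_diff)
  show "r *\<^sub>R (f + g) = r *\<^sub>R f + r *\<^sub>R g"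
    by transfer (auto simp: l2_rel_def sq_integrable_add sq_integrable_scaleR scaleR_add_right
        simp del: real_scaleR_def)
  show "(r + s) *\<^sub>R f = r *\<^sub>R f + s *\<^sub>R f"
    by transfer (auto simp: l2_rel_def sq_integrable_add sq_integrable_scaleR scaleR_add_left)
  show "r *\<^sub>R s *\<^sub>R f = (r * s) *\<^sub>R f"
    by transfer (auto simp: l2_rel_def sq_integrable_scaleR)
  show "1 *\<^sub>R f = f"
    by transfer (auto simp: l2_rel_def)
qed

end

text \<open>The real inner product space structure underlying the complex one.  It provides the
  \<open>L\<^sup>2\<close> norm \<open>norm f = sqrt (Re \<langle>f, f\<rangle>)\<close> and hence the topology in which series in \<open>l2\<close> converge.\<close>

instantiation l2 :: real_inner
begin

definition inner_l2 :: "l2 \<Rightarrow> l2 \<Rightarrow> real" where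
  "inner_l2 f g = Re \<langle>f, g\<rangle>"

definition norm_l2 :: "l2 \<Rightarrow> real" where
  "norm_l2 f = sqrt (inner f f)"

definition sgn_l2 :: "l2 \<Rightarrow> l2" where
  "sgn_l2 f = f /\<^sub>R norm f"

definition dist_l2 :: "l2 \<Rightarrow> l2 \<Rightarrow> real" where
  "dist_l2 f g = norm (f - g)"

definition uniformity_l2 :: "(l2 \<times> l2) filter" where
  "uniformity_l2 = (INF e\<in>{0<..}. principal {(f, g). dist f g < e})"

definition open_l2 :: "l2 set \<Rightarrow> bool" where
  "open_l2 U \<longleftrightarrow> (\<forall>x\<in>U. eventually (\<lambda>(x', y). x' = x \<longrightarrow> y \<in> U) uniformity)"

instance
proof
  fix f g h :: l2 and r :: real
  show "sgn f = f /\<^sub>R norm f"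
    by (rule sgn_l2_def)
  show "dist f g = norm (f - g)"
    by (rule dist_l2_def)
  show "(uniformity :: (l2 \<times> l2) filter) = (INF e\<in>{0<..}. principal {(f, g). dist f g < e})"
    by (rule uniformity_l2_def)
  show "open U \<longleftrightarrow> (\<forall>x\<in>U. eventually (\<lambda>(x', y). x' = x \<longrightarrow> y \<in> U) uniformity)" for U :: "l2 set"
    by (rule open_l2_def)
  have "\<langle>g, f\<rangle> = cnj \<langle>f, g\<rangle>"
    by transfer (simp flip: Bochner_Integration.integral_cnj add: mult.commute)
  then show "inner f g = inner g f"
    by (simp add: inner_l2_def)
  have "\<langle>f + g, h\<rangle> = \<langle>f, h\<rangle> + \<langle>g, h\<rangle>"
    by transfer (simp add: l2_rel_def sq_integrable_mult distrib_right)
  then show "inner (f + g) h = inner f h + inner g h"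
    by (simp add: inner_l2_def)
  have "\<langle>r *\<^sub>R f, g\<rangle> = r *\<^sub>R \<langle>f, g\<rangle>"
    by transfer simp
  then show "inner (r *\<^sub>R f) g = r * inner f g"
    by (simp add: inner_l2_def)
  have *: "inner f f \<ge> 0 \<and> (inner f f = 0 \<longleftrightarrow> f = 0)"
    unfolding inner_l2_def
  proof transfer
    fix f assume "l2_rel f f"
    then have f: "sq_integrable f" by (simp add: l2_rel_def)
    have eq: "Re (LINT x|leb01. f x * cnj (f x)) = (LINT x|leb01. (cmod (f x))\<^sup>2)"
      using sq_integrable_mult[OF f f]
      by (simp only: integral_Re[symmetric] Re_mult_cnj)
    have "(LINT x|leb01. (cmod (f x))\<^sup>2) = 0 \<longleftrightarrow> (AE x in leb01. (cmod (f x))\<^sup>2 = 0)"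
      using f by (intro integral_nonneg_eq_0_iff_AE) (auto simp: sq_integrable_def)
    then show "0 \<le> Re (LINT x|leb01. f x * cnj (f x)) \<and>
      (Re (LINT x|leb01. f x * cnj (f x)) = 0 \<longleftrightarrow> l2_rel f (\<lambda>x. 0))"
      unfolding eq using f by (auto simp: l2_rel_def sq_integrable_0)
  qed
  then show "inner f f \<ge> 0" "inner f f = 0 \<longleftrightarrow> f = 0"
    by auto
  show "norm f = sqrt (inner f f)"
    by (rule norm_l2_def)
qed

end

section \<open>Unbounded operators, spectrum and resolvent\<close>

text \<open>An operator is given by its domain and a map of which only the values on the domain matter.\<close>

type_synonym l2_operator = "l2 set \<times> (l2 \<Rightarrow> l2)"

definition resolvent_set :: "l2_operator \<Rightarrow> complex set" where
  "resolvent_set A = {z.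
     bij_betw (\<lambda>y. snd A y - z *\<^sub>C y) (fst A) UNIV \<and>
     (\<exists>C. \<forall>y\<in>fst A. norm y \<le> C * norm (snd A y - z *\<^sub>C y))}"

definition spectrum :: "l2_operator \<Rightarrow> complex set" where
  "spectrum A = - resolvent_set A"

definition resolvent :: "l2_operator \<Rightarrow> complex \<Rightarrow> l2 \<Rightarrow> l2" where
  "resolvent A z = inv_into (fst A) (\<lambda>y. snd A y - z *\<^sub>C y)"

section \<open>The Sobolev space and the operators\<close>

definition abs_cont_on :: "real \<Rightarrow> real \<Rightarrow> (real \<Rightarrow> complex) \<Rightarrow> bool" where
  "abs_cont_on a b h \<longleftrightarrow>
     (\<forall>\<epsilon>>0. \<exists>\<delta>>0. \<forall>I :: (real \<times> real) set.
        finite I \<and> (\<forall>(s, t)\<in>I. a \<le> s \<and> s \<le> t \<and> t \<le> b) \<and>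
        disjoint_family_on (\<lambda>(s, t). {s<..<t}) I \<and> (\<Sum>(s, t)\<in>I. t - s) < \<delta> \<longrightarrow>
        (\<Sum>(s, t)\<in>I. cmod (h t - h s)) < \<epsilon>)"

text \<open>\<open>has_derivs3 y h0 h1 h2 w\<close> says that the class \<open>y\<close> lies in the Sobolev space \<open>W_3^2(0,1)\<close>,
  in its classical one-dimensional definition: on \<open>[0,1]\<close>, \<open>y\<close> has a twice continuously
  differentiable representative \<open>h0\<close> with \<open>y' = h1\<close> and \<open>y'' = h2\<close>, the function \<open>h2\<close> is absolutely
  continuous, and its almost everywhere derivative \<open>y'''\<close> is square-integrable with class \<open>w\<close>.
  The values \<open>h0 x\<close>, \<open>h1 x\<close>, \<open>h2 x\<close> for \<open>x \<in> [0,1]\<close>, in particular the boundary values, and the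
  class \<open>w\<close> are determined by \<open>y\<close>.\<close>

definition has_derivs3 ::
  "l2 \<Rightarrow> (real \<Rightarrow> complex) \<Rightarrow> (real \<Rightarrow> complex) \<Rightarrow> (real \<Rightarrow> complex) \<Rightarrow> l2 \<Rightarrow> bool" where
  "has_derivs3 y h0 h1 h2 w \<longleftrightarrow>
     sq_integrable h0 \<and> y = abs_l2 h0 \<and>
     (\<forall>x\<in>{0..1}. (h0 has_vector_derivative h1 x) (at x within {0..1})) \<and>
     (\<forall>x\<in>{0..1}. (h1 has_vector_derivative h2 x) (at x within {0..1})) \<and>
     abs_cont_on 0 1 h2 \<and>
     (\<exists>h3. (AE x in leb01. (h2 has_vector_derivative h3 x) (at x)) \<and>
           sq_integrable h3 \<and> w = abs_l2 h3)"

definition third_deriv :: "l2 \<Rightarrow> l2" where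
  "third_deriv y = (THE w. \<exists>h0 h1 h2. has_derivs3 y h0 h1 h2 w)"

definition L_dom :: "l2 set" where
  "L_dom = {y. \<exists>h0 h1 h2 w. has_derivs3 y h0 h1 h2 w \<and>
     h0 1 = h0 0 \<and> h1 1 = h1 0 \<and> h2 1 = h2 0}"

text \<open>\<open>L_op 0 v\<close> is the unperturbed operator, whatever \<open>v\<close> is.\<close>

definition L_op :: "real \<Rightarrow> l2 \<Rightarrow> l2_operator" where
  "L_op \<alpha> v =
     (L_dom, \<lambda>y. \<i> *\<^sub>C third_deriv y + (complex_of_real \<alpha> * \<langle>y, v\<rangle>) *\<^sub>C v)"

definition eigval :: "int \<Rightarrow> complex" where
  "eigval n = (2 * of_int n * of_real pi) ^ 3"

definition eigfun :: "int \<Rightarrow> l2" where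
  "eigfun n = abs_l2 (\<lambda>x. exp (2 * of_int n * of_real pi * \<i> * of_real x))"

definition fourier_coeff :: "l2 \<Rightarrow> int \<Rightarrow> complex" where
  "fourier_coeff f n = \<langle>f, eigfun n\<rangle>"

end

(*
  The resolvent R of L_0 at z is a bounded linear bijection onto the domain, and
  R u_n = u_n / (z_n - z) because u_n is an eigenfunction.  Applying R to the Fourier expansion of f,
  which converges in the mean, gives the series for R f; pairing it with v gives the scalar series.
  So no integration by parts on the domain is needed, only completeness of the exponentials:
  functions with a convergent Fourier expansion form a closed subspace, and dominated convergence
  reduces a square-integrable function successively to a bounded one, to a continuous one, and to
  one with equal values at 0 and 1.
  As L_\<alpha> - z maps R g to g + \<alpha> <R g, v> v, the resolvent of L_\<alpha> comes from solving a scalar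
  equation; were its coefficient 1 + \<alpha> <R v, v> zero, R v would be a nonzero element of the
  kernel of L_\<alpha> - z.
*)

theory Submission
  imports Defs
begin

section \<open>The space \<open>L\<^sup>2(0,1)\<close>\<close>

text \<open>The quotient is partial: \<open>abs_l2\<close> is unspecified on functions that are not
  square-integrable. Every rule for computing with representatives therefore carries integrability
  hypotheses.\<close>

lemma scaleC_abs_l2: "sq_integrable f \<Longrightarrow> c *\<^sub>C abs_l2 f = abs_l2 (\<lambda>x. c * f x)"
  by (rule scaleC.abs_eq) (simp add: l2_rel_def)

lemma add_abs_l2: "sq_integrable f \<Longrightarrow> sq_integrable g \<Longrightarrow> abs_l2 f + abs_l2 g = abs_l2 (\<lambda>x. f x + g x)"
  by (rule plus_l2.abs_eq) (simp_all add: l2_rel_def)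

lemma diff_abs_l2: "sq_integrable f \<Longrightarrow> sq_integrable g \<Longrightarrow> abs_l2 f - abs_l2 g = abs_l2 (\<lambda>x. f x - g x)"
  by (rule minus_l2.abs_eq) (simp_all add: l2_rel_def)

lemma cinner_abs_l2:
  "sq_integrable f \<Longrightarrow> sq_integrable g \<Longrightarrow> \<langle>abs_l2 f, abs_l2 g\<rangle> = (LINT x|leb01. f x * cnj (g x))"
  by (rule cinner.abs_eq) (simp_all add: l2_rel_def)

lemma abs_l2_eq_iff:
  assumes "sq_integrable f" "sq_integrable g"
  shows "abs_l2 f = abs_l2 g \<longleftrightarrow> (AE x in leb01. f x = g x)"
  using Quotient_rel[OF Quotient_l2, of f g] assms by (simp add: l2_rel_def)

lemma l2_cases:
  obtains f where "sq_integrable f" "y = abs_l2 f"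
proof -
  have "l2_rel (rep_l2 y) (rep_l2 y)" "abs_l2 (rep_l2 y) = y"
    using Quotient_rep_reflp[OF Quotient_l2] Quotient_abs_rep[OF Quotient_l2] by auto
  then show thesis using that[of "rep_l2 y"] by (simp add: l2_rel_def)
qed

lemma norm_abs_l2:
  assumes "sq_integrable f"
  shows "norm (abs_l2 f) = sqrt (LINT x|leb01. (cmod (f x))\<^sup>2)"
proof -
  have "Re \<langle>abs_l2 f, abs_l2 f\<rangle> = (LINT x|leb01. Re (f x * cnj (f x)))"
    unfolding cinner_abs_l2[OF assms assms] using sq_integrable_mult[OF assms assms]
    by (simp only: integral_Re)
  then show ?thesis
    by (simp only: norm_l2_def inner_l2_def Re_mult_cnj)
qed

section \<open>Complex linear algebra in the Hilbert space\<close>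

lemma cinner_add_left: "\<langle>f + g, h\<rangle> = \<langle>f, h\<rangle> + \<langle>g, h\<rangle>"
  by transfer (simp add: l2_rel_def sq_integrable_mult distrib_right)

lemma cinner_scaleC_left: "\<langle>c *\<^sub>C f, h\<rangle> = c * \<langle>f, h\<rangle>"
  by transfer (simp add: mult.assoc)

lemma cinner_commute: "\<langle>g, f\<rangle> = cnj \<langle>f, g\<rangle>"
  by transfer (simp flip: Bochner_Integration.integral_cnj add: mult.commute)

lemma cinner_add_right: "\<langle>h, f + g\<rangle> = \<langle>h, f\<rangle> + \<langle>h, g\<rangle>"
  by (subst (1 2 3) cinner_commute) (simp add: cinner_add_left)

lemma cinner_scaleC_right: "\<langle>h, c *\<^sub>C f\<rangle> = cnj c * \<langle>h, f\<rangle>"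
  by (subst (1 2) cinner_commute) (simp add: cinner_scaleC_left)

text \<open>Links the two structures on \<open>l2\<close>: \<open>bounded_linear\<close> and the
  topology refer to real scalars, the operators to complex ones.\<close>

lemma scaleR_eq_scaleC: "r *\<^sub>R f = complex_of_real r *\<^sub>C f"
  by transfer (simp add: l2_rel_def sq_integrable_scaleR scaleR_conv_of_real sq_integrable_scale)

lemma scaleC_add_right: "c *\<^sub>C (f + g) = c *\<^sub>C f + c *\<^sub>C g"
  by transfer (auto simp: l2_rel_def sq_integrable_scale sq_integrable_add algebra_simps)

lemma scaleC_add_left: "(c + d) *\<^sub>C f = c *\<^sub>C f + d *\<^sub>C f"
  by transfer (auto simp: l2_rel_def sq_integrable_scale sq_integrable_add algebra_simps)

lemma scaleC_scaleC: "c *\<^sub>C d *\<^sub>C f = (c * d) *\<^sub>C f"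
  by transfer (auto simp: l2_rel_def sq_integrable_scale mult.assoc)

lemma scaleC_one [simp]: "1 *\<^sub>C f = f"
  by transfer (auto simp: l2_rel_def)

lemma scaleC_zero_left [simp]: "0 *\<^sub>C f = 0"
  using scaleC_add_left[of 0 0 f] by simp

lemma scaleC_zero_right [simp]: "c *\<^sub>C 0 = 0"
  using scaleC_add_right[of c 0 0] by simp

lemma scaleC_minus_left: "(- c) *\<^sub>C f = - (c *\<^sub>C f)"
  using scaleC_add_left[of "-c" c f] by (simp add: eq_neg_iff_add_eq_0)

lemma scaleC_minus_right: "c *\<^sub>C (- f) = - (c *\<^sub>C f)"
  using scaleC_add_right[of c "-f" f] by (simp add: eq_neg_iff_add_eq_0)

lemma scaleC_diff_right: "c *\<^sub>C (f - g) = c *\<^sub>C f - c *\<^sub>C g"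
  using scaleC_add_right[of c f "-g"] by (simp add: scaleC_minus_right)

lemma scaleC_diff_left: "(c - d) *\<^sub>C f = c *\<^sub>C f - d *\<^sub>C f"
  using scaleC_add_left[of c "-d" f] by (simp add: scaleC_minus_left)

lemma cinner_zero_left [simp]: "\<langle>0, h\<rangle> = 0"
  using cinner_add_left[of 0 0 h] by simp

lemma cinner_zero_right [simp]: "\<langle>h, 0\<rangle> = 0"
  using cinner_add_right[of h 0 0] by simp

lemma cinner_minus_left: "\<langle>- f, h\<rangle> = - \<langle>f, h\<rangle>"
  using cinner_add_left[of "-f" f h] by (simp add: eq_neg_iff_add_eq_0)

lemma cinner_diff_left: "\<langle>f - g, h\<rangle> = \<langle>f, h\<rangle> - \<langle>g, h\<rangle>"
  using cinner_add_left[of f "-g" h] by (simp add: cinner_minus_left)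

lemma cinner_sum_left: "\<langle>\<Sum>i\<in>A. f i, h\<rangle> = (\<Sum>i\<in>A. \<langle>f i, h\<rangle>)"
  by (induction A rule: infinite_finite_induct) (simp_all add: cinner_add_left)

lemma cinner_sum_right: "\<langle>h, \<Sum>i\<in>A. f i\<rangle> = (\<Sum>i\<in>A. \<langle>h, f i\<rangle>)"
  by (induction A rule: infinite_finite_induct) (simp_all add: cinner_add_right)

lemma norm_scaleC: "norm (c *\<^sub>C f) = cmod c * norm (f :: l2)"
proof -
  have "\<langle>c *\<^sub>C f, c *\<^sub>C f\<rangle> = of_real ((cmod c)\<^sup>2) * \<langle>f, f\<rangle>"
    unfolding complex_norm_square cinner_scaleC_left cinner_scaleC_right
    by simp
  then have "inner (c *\<^sub>C f) (c *\<^sub>C f) = (cmod c)\<^sup>2 * inner f f"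
    unfolding inner_l2_def by (simp del: of_real_power)
  then show ?thesis
    by (simp add: norm_l2_def real_sqrt_mult)
qed

lemma bounded_linear_scaleC: "bounded_linear (\<lambda>f. c *\<^sub>C f)"
  by (rule bounded_linear_intro[of _ "cmod c"])
    (simp_all add: scaleC_add_right scaleR_eq_scaleC scaleC_scaleC mult.commute norm_scaleC)

text \<open>The real Cauchy-Schwarz inequality is applied to the real and imaginary parts
  separately, whence the factor 2. Only boundedness matters later, so the sharp constant is not
  sought.\<close>

lemma norm_cinner_le: "cmod \<langle>f, g\<rangle> \<le> 2 * norm f * norm g"
proof -
  have "\<bar>Re \<langle>f, g\<rangle>\<bar> \<le> norm f * norm g"
    using Cauchy_Schwarz_ineq2[of f g] by (simp add: inner_l2_def)
  \<comment> \<open>Multiplying \<open>f\<close> by \<open>- \<i>\<close> leaves the norm unchanged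
    and turns the imaginary part of the inner product into its real part.\<close>
  moreover have "\<bar>Im \<langle>f, g\<rangle>\<bar> \<le> norm f * norm g"
    using Cauchy_Schwarz_ineq2[of "(- \<i>) *\<^sub>C f" g]
    by (simp add: inner_l2_def cinner_scaleC_left norm_scaleC)
  ultimately show ?thesis
    using cmod_le[of "\<langle>f, g\<rangle>"] by linarith
qed

lemma bounded_linear_cinner: "bounded_linear (\<lambda>f. \<langle>f, g\<rangle>)"
  by (rule bounded_linear_intro[of _ "2 * norm g"])
    (use norm_cinner_le[of _ g] in \<open>simp_all add: cinner_add_left cinner_scaleC_left scaleR_eq_scaleC
      scaleR_conv_of_real algebra_simps\<close>)

section \<open>Integration on the unit interval and convergence in the mean\<close>

lemma AE_leb01_iff: "(AE x in leb01. P x) \<longleftrightarrow> (AE x in lebesgue. x \<in> {0<..<1} \<longrightarrow> P x)"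
  by (rule AE_restrict_space_iff) simp

lemma AE_leb01I: "(\<And>x. 0 < x \<Longrightarrow> x < 1 \<Longrightarrow> P x) \<Longrightarrow> AE x in leb01. P x"
  by (simp add: AE_leb01_iff)

lemma finite_measure_leb01: "finite_measure leb01"
  by (rule finite_measureI) (simp add: space_restrict_space emeasure_restrict_space)

lemma sq_integrable_bounded:
  assumes "f \<in> borel_measurable leb01" "\<And>x. 0 < x \<Longrightarrow> x < 1 \<Longrightarrow> cmod (f x) \<le> B"
  shows "sq_integrable f"
  unfolding sq_integrable_def
proof
  interpret finite_measure leb01 by (rule finite_measure_leb01)
  have [measurable]: "f \<in> borel_measurable leb01" by fact
  show "integrable leb01 (\<lambda>x. (cmod (f x))\<^sup>2)"
    by (rule integrable_const_bound[where B="B\<^sup>2"]) (auto intro!: AE_leb01I power_mono assms)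
qed fact

lemma sq_integrable_continuous:
  assumes "continuous_on {0..1} f"
  shows "sq_integrable f"
proof -
  have "compact (f ` {0..1})" using assms by (intro compact_continuous_image) auto
  then obtain B where "\<forall>x\<in>{0..1}. cmod (f x) \<le> B"
    by (metis compact_imp_bounded bounded_iff image_eqI)
  moreover have "f \<in> borel_measurable leb01"
    by (rule continuous_imp_measurable_on_sets_lebesgue)
      (auto intro: continuous_on_subset[OF assms])
  ultimately show ?thesis by (intro sq_integrable_bounded[of f B]) auto
qed

text \<open>The interval has total mass 1, so no extra factor appears. This turns uniform
  approximation into approximation in the mean.\<close>

lemma norm_abs_l2_le:
  assumes "sq_integrable f" "\<And>x. 0 < x \<Longrightarrow> x < 1 \<Longrightarrow> cmod (f x) \<le> B"
  shows "norm (abs_l2 f) \<le> B"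
proof -
  interpret finite_measure leb01 by (rule finite_measure_leb01)
  have "0 \<le> B" using order_trans[OF norm_ge_zero assms(2)[of "1/2"]] by simp
  have "(LINT x|leb01. (cmod (f x))\<^sup>2) \<le> (LINT x|leb01. B\<^sup>2)"
    using assms by (intro integral_mono_AE) (auto simp: sq_integrable_def intro!: AE_leb01I power_mono)
  then show ?thesis
    using \<open>0 \<le> B\<close> by (simp add: norm_abs_l2[OF assms(1)] real_le_lsqrt measure_restrict_space)
qed

text \<open>Dominated convergence in mean square, stated for representatives. It serves every
  approximation below that converges only pointwise; the majorant \<open>w\<close> bounds the limit
  as well as the sequence.\<close>

lemma tendsto_abs_l2:
  assumes [measurable]: "f \<in> borel_measurable leb01" "\<And>i. s i \<in> borel_measurable leb01"
    and w: "integrable leb01 (\<lambda>x. (w x)\<^sup>2)"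
    and lim: "AE x in leb01. (\<lambda>i. s i x) \<longlonglongrightarrow> f x"
    and bound: "\<And>i. AE x in leb01. cmod (s i x) \<le> w x"
  shows "sq_integrable f" and "\<And>i. sq_integrable (s i)" and "(\<lambda>i. abs_l2 (s i)) \<longlonglongrightarrow> abs_l2 f"
proof -
  have "AE x in leb01. \<forall>i. cmod (s i x) \<le> w x"
    using bound by (simp add: AE_all_countable)
  with lim have f_bound: "AE x in leb01. cmod (f x) \<le> w x"
  proof eventually_elim
    case (elim x)
    then show ?case
      by (intro LIMSEQ_le_const2[OF tendsto_norm[of "\<lambda>i. s i x"]]) auto
  qed
  have sq: "sq_integrable g"
    if [measurable]: "g \<in> borel_measurable leb01" and "AE x in leb01. cmod (g x) \<le> w x" for g
    unfolding sq_integrable_def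
  proof
    show "integrable leb01 (\<lambda>x. (cmod (g x))\<^sup>2)"
      using w
    proof (rule Bochner_Integration.integrable_bound)
      show "AE x in leb01. norm ((cmod (g x))\<^sup>2) \<le> norm ((w x)\<^sup>2)"
        using that(2) by eventually_elim (simp add: power_mono)
    qed measurable
  qed fact
  show f: "sq_integrable f" and s: "\<And>i. sq_integrable (s i)"
    using sq f_bound bound by auto
  have "(\<lambda>i. LINT x|leb01. (cmod (s i x - f x))\<^sup>2) \<longlonglongrightarrow> (LINT x|leb01. 0)"
  proof (rule integral_dominated_convergence)
    \<comment> \<open>Both \<open>s i\<close> and \<open>f\<close> are bounded by \<open>w\<close>,
      so their difference is at most \<open>2 * w x\<close>; squaring gives the factor 4.\<close>
    show "integrable leb01 (\<lambda>x. 4 * (w x)\<^sup>2)"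
      using w by simp
    show "AE x in leb01. (\<lambda>i. (cmod (s i x - f x))\<^sup>2) \<longlonglongrightarrow> 0"
      using lim by eventually_elim (auto intro!: tendsto_eq_intros)
    show "AE x in leb01. norm ((cmod (s i x - f x))\<^sup>2) \<le> 4 * (w x)\<^sup>2" for i
      using bound[of i] f_bound
    proof eventually_elim
      case (elim x)
      then have "cmod (s i x - f x) \<le> 2 * w x"
        using norm_triangle_ineq4[of "s i x" "f x"] by linarith
      then have "(cmod (s i x - f x))\<^sup>2 \<le> (2 * w x)\<^sup>2"
        by (intro power_mono) auto
      then show ?case by (simp add: power_mult_distrib)
    qed
  qed measurable
  then have "(\<lambda>i. norm (abs_l2 (s i) - abs_l2 f)) \<longlonglongrightarrow> sqrt 0"
    unfolding diff_abs_l2[OF s f] norm_abs_l2[OF sq_integrable_diff[OF s f]]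
    by (intro tendsto_real_sqrt) simp
  then show "(\<lambda>i. abs_l2 (s i)) \<longlonglongrightarrow> abs_l2 f"
    by (simp add: tendsto_norm_zero_iff LIM_zero_iff)
qed

section \<open>Fourier expansions in the mean\<close>

text \<open>A pointwise representative of \<open>eigfun n\<close>, on which products, boundary
  values and derivatives can be computed.\<close>

definition fourier_exp :: "int \<Rightarrow> real \<Rightarrow> complex" where
  "fourier_exp n x = exp (2 * of_int n * of_real pi * \<i> * of_real x)"

lemma fourier_exp_add: "fourier_exp (m + n) x = fourier_exp m x * fourier_exp n x"
  by (simp add: fourier_exp_def exp_add[symmetric] algebra_simps)

lemma fourier_exp_0 [simp]: "fourier_exp 0 x = 1"
  by (simp add: fourier_exp_def)

lemma cnj_fourier_exp: "cnj (fourier_exp n x) = fourier_exp (- n) x"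
  by (simp add: fourier_exp_def exp_cnj)

lemma fourier_exp_at_1 [simp]: "fourier_exp n 1 = 1"
  unfolding fourier_exp_def using exp_integer_2pi[of "of_int n"] by (simp add: algebra_simps)

lemma fourier_exp_at_0 [simp]: "fourier_exp n 0 = 1"
  by (simp add: fourier_exp_def)

lemma fourier_exp_has_vector_derivative:
  "(fourier_exp n has_vector_derivative 2 * of_int n * of_real pi * \<i> * fourier_exp n x) (at x within S)"
  unfolding fourier_exp_def
  by (rule has_vector_derivative_real_field) (auto intro!: derivative_eq_intros)

lemma continuous_on_fourier_exp [continuous_intros]: "continuous_on S (fourier_exp n)"
  unfolding fourier_exp_def by (intro continuous_intros)

lemma sq_integrable_fourier_exp: "sq_integrable (fourier_exp n)"
  by (intro sq_integrable_continuous continuous_intros)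

lemma eigfun_eq: "eigfun n = abs_l2 (fourier_exp n)"
  by (simp add: eigfun_def fourier_exp_def[abs_def])

lemma has_integral_fourier_exp:
  "(fourier_exp n has_integral (if n = 0 then 1 else 0)) {0..1}"
proof (cases "n = 0")
  case True
  then have "fourier_exp n = (\<lambda>x. 1)" by auto
  then show ?thesis using True has_integral_const_real[of "1::complex" 0 1] by simp
next
  case False
  define c where "c = 2 * of_int n * of_real pi * \<i>"
  have "c \<noteq> 0" using False by (simp add: c_def)
  have "((\<lambda>x. fourier_exp n x / c) has_vector_derivative fourier_exp n x) (at x within {0..1})" for x
    using has_vector_derivative_divide[OF fourier_exp_has_vector_derivative[of n x "{0..1}"], of c] \<open>c \<noteq> 0\<close>
    by (simp add: c_def)
  \<comment> \<open>For nonzero \<open>n\<close> the antiderivative takes the same value at 0 and 1,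
    so the integral vanishes.\<close>
  then have "(fourier_exp n has_integral fourier_exp n 1 / c - fourier_exp n 0 / c) {0..1}"
    by (intro fundamental_theorem_of_calculus) auto
  then show ?thesis using False by simp
qed

lemma cinner_eigfun: "\<langle>eigfun m, eigfun n\<rangle> = (if m = n then 1 else 0)"
proof -
  have "\<langle>eigfun m, eigfun n\<rangle> = (LINT x|leb01. fourier_exp (m - n) x)"
    by (simp add: eigfun_eq cinner_abs_l2 sq_integrable_fourier_exp cnj_fourier_exp
        flip: fourier_exp_add)
  also have "\<dots> = integral {0<..<1} (fourier_exp (m - n))"
  proof (rule lebesgue_integral_eq_integral)
    show "integrable leb01 (fourier_exp (m - n))"
      using sq_integrable_mult[OF sq_integrable_fourier_exp[of "m - n"] sq_integrable_fourier_exp[of 0]]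
      by simp
  qed auto
  also have "\<dots> = integral {0..1} (fourier_exp (m - n))"
    by (simp add: integral_open_interval_real)
  also have "\<dots> = (if m = n then 1 else 0)"
    using integral_unique[OF has_integral_fourier_exp[of "m - n"]] by simp
  finally show ?thesis .
qed

section \<open>Fourier partial sums and stability of Fourier expansions under limits\<close>

definition fourier_sum :: "int set \<Rightarrow> l2 \<Rightarrow> l2" where
  "fourier_sum S f = (\<Sum>n\<in>S. fourier_coeff f n *\<^sub>C eigfun n)"

text \<open>\<open>has_sum\<close> over \<open>UNIV\<close> is convergence in norm along the finite
  sets of integers, hence unconditional; no ordering of the two-sided series has to be
  chosen.\<close>

definition has_fourier_series :: "l2 \<Rightarrow> bool" where
  "has_fourier_series f \<longleftrightarrow> ((\<lambda>n. fourier_coeff f n *\<^sub>C eigfun n) has_sum f) UNIV"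

lemma fourier_sum_diff: "fourier_sum S (f - g) = fourier_sum S f - fourier_sum S g"
  by (simp add: fourier_sum_def fourier_coeff_def cinner_diff_left scaleC_diff_left sum_subtractf)

text \<open>By orthonormality the remainder is orthogonal to the partial sum, and Pythagoras
  applies. The bound is uniform in \<open>S\<close>, which is what passing to limits
  requires.\<close>

lemma norm_diff_fourier_sum_le:
  assumes "finite S"
  shows "norm (f - fourier_sum S f) \<le> norm f"
proof -
  have "\<langle>f - fourier_sum S f, eigfun m\<rangle> = 0" if "m \<in> S" for m
  proof -
    have "\<langle>fourier_sum S f, eigfun m\<rangle> = (\<Sum>n\<in>S. if n = m then fourier_coeff f n else 0)"
      unfolding fourier_sum_def cinner_sum_left
      by (rule sum.cong) (simp_all add: cinner_scaleC_left cinner_eigfun)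
    then show ?thesis
      using assms that by (simp add: cinner_diff_left fourier_coeff_def)
  qed
  then have "\<langle>f - fourier_sum S f, fourier_sum S f\<rangle> = 0"
    by (subst (2) fourier_sum_def) (simp add: cinner_sum_right cinner_scaleC_right)
  then have "orthogonal (f - fourier_sum S f) (fourier_sum S f)"
    by (simp add: orthogonal_def inner_l2_def)
  then have "(norm (f - fourier_sum S f + fourier_sum S f))\<^sup>2
      = (norm (f - fourier_sum S f))\<^sup>2 + (norm (fourier_sum S f))\<^sup>2"
    by (rule norm_add_Pythagorean)
  then have "(norm (f - fourier_sum S f))\<^sup>2 \<le> (norm f)\<^sup>2"
    by simp
  then show ?thesis
    by (rule power2_le_imp_le) simp
qed

lemma has_fourier_series_add:
  "has_fourier_series f \<Longrightarrow> has_fourier_series g \<Longrightarrow> has_fourier_series (f + g)"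
  unfolding has_fourier_series_def
  by (drule (1) has_sum_add) (simp add: fourier_coeff_def cinner_add_left scaleC_add_left)

lemma has_fourier_series_scaleC:
  assumes "has_fourier_series f"
  shows "has_fourier_series (c *\<^sub>C f)"
  using has_sum_bounded_linear[OF bounded_linear_scaleC assms[unfolded has_fourier_series_def], of c]
  by (simp add: has_fourier_series_def fourier_coeff_def cinner_scaleC_left scaleC_scaleC)

lemma has_fourier_series_eigfun: "has_fourier_series (eigfun m)"
  unfolding has_fourier_series_def
  by (rule has_sum_finite_neutralI[of "{m}"]) (auto simp: fourier_coeff_def cinner_eigfun)

lemma has_fourier_series_limit:
  assumes lim: "g \<longlonglongrightarrow> f" and g: "\<And>i::nat. has_fourier_series (g i)"
  shows "has_fourier_series f"
  unfolding has_fourier_series_def has_sum_def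
proof (rule tendstoI)
  fix e :: real assume "e > 0"
  then obtain i where i: "dist (g i) f < e / 2"
    using lim[unfolded lim_sequentially, rule_format, of "e / 2"] by auto
  have "((\<lambda>S. fourier_sum S (g i)) \<longlongrightarrow> g i) (finite_subsets_at_top UNIV)"
    using g[of i] by (simp add: has_fourier_series_def has_sum_def fourier_sum_def)
  then have "\<forall>\<^sub>F S in finite_subsets_at_top UNIV. dist (fourier_sum S (g i)) (g i) < e / 2"
    using \<open>e > 0\<close> by (intro tendstoD) auto
  moreover have "\<forall>\<^sub>F S in finite_subsets_at_top UNIV. finite (S :: int set)"
    by (auto simp: eventually_finite_subsets_at_top)
  ultimately show "\<forall>\<^sub>F S in finite_subsets_at_top UNIV.
      dist (\<Sum>n\<in>S. fourier_coeff f n *\<^sub>C eigfun n) f < e"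
  proof eventually_elim
    case (elim S)
    \<comment> \<open>The remainder is additive. That of \<open>f - g i\<close> is small for every
      finite \<open>S\<close> by the uniform bound, that of \<open>g i\<close> for large
      \<open>S\<close> by its own expansion.\<close>
    have "f - fourier_sum S f = (f - g i - fourier_sum S (f - g i)) + (g i - fourier_sum S (g i))"
      by (simp add: fourier_sum_diff)
    then have "norm (f - fourier_sum S f)
        \<le> norm (f - g i - fourier_sum S (f - g i)) + norm (g i - fourier_sum S (g i))"
      using norm_triangle_ineq by metis
    also have "\<dots> \<le> norm (f - g i) + norm (g i - fourier_sum S (g i))"
      using norm_diff_fourier_sum_le[OF elim(2)] by simp
    also have "\<dots> < e"
      using elim(1) i by (simp add: dist_norm norm_minus_commute)
    finally show ?case by (simp add: dist_norm norm_minus_commute fourier_sum_def)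
  qed
qed

section \<open>Trigonometric polynomials and uniform approximation\<close>

inductive trig_polynomial :: "(real \<Rightarrow> complex) \<Rightarrow> bool" where
  monomial: "trig_polynomial (\<lambda>x. c * fourier_exp n x)"
| add: "trig_polynomial p \<Longrightarrow> trig_polynomial q \<Longrightarrow> trig_polynomial (\<lambda>x. p x + q x)"

lemma continuous_on_trig_polynomial: "trig_polynomial p \<Longrightarrow> continuous_on S p"
  by (induction rule: trig_polynomial.induct) (intro continuous_intros; assumption)+

lemma has_fourier_series_trig_polynomial:
  "trig_polynomial p \<Longrightarrow> has_fourier_series (abs_l2 p)"
proof (induction rule: trig_polynomial.induct)
  case (monomial c n)
  then show ?case
    using has_fourier_series_scaleC[OF has_fourier_series_eigfun[of n], of c]
    by (simp add: eigfun_eq scaleC_abs_l2 sq_integrable_fourier_exp)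
next
  case (add p q)
  then show ?case
    using has_fourier_series_add[of "abs_l2 p" "abs_l2 q"]
    by (simp add: add_abs_l2 sq_integrable_continuous continuous_on_trig_polynomial)
qed

lemma trig_polynomial_mult:
  assumes "trig_polynomial p" "trig_polynomial q"
  shows "trig_polynomial (\<lambda>x. p x * q x)"
  using assms(1)
proof (induction rule: trig_polynomial.induct)
  case (monomial c n)
  show ?case
    using assms(2)
  proof (induction rule: trig_polynomial.induct)
    case (monomial d m)
    show ?case
      using trig_polynomial.monomial[of "c * d" "n + m"] by (simp add: fourier_exp_add mult_ac)
  next
    case (add q r)
    then show ?case
      using trig_polynomial.add[OF add.IH] by (simp add: algebra_simps)
  qed
next
  case (add p r)
  then show ?case
    using trig_polynomial.add[OF add.IH] by (simp add: algebra_simps)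
qed

text \<open>Bridges the polynomials supplied by Stone-Weierstrass, which are polynomials in the real
  coordinates of the plane, to exponentials. Real-linear functionals combine a point
  \<open>w\<close> and its conjugate, which on the circle are the frequencies 1 and -1; sums and
  products follow by closure.\<close>

lemma trig_polynomial_real_polynomial:
  "real_polynomial_function q \<Longrightarrow> trig_polynomial (\<lambda>x. of_real (q (fourier_exp 1 x)))"
proof (induction rule: real_polynomial_function.induct)
  case (linear f)
  interpret bounded_linear f by fact
  \<comment> \<open>The coefficients come from writing \<open>Re w\<close> as
    \<open>(w + cnj w) / 2\<close> and \<open>Im w\<close> as
    \<open>(w - cnj w) / (2 * \<i>)\<close>.\<close>
  have "of_real (f (fourier_exp 1 x)) =
      (of_real (f 1) - \<i> * of_real (f \<i>)) / 2 * fourier_exp 1 x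
      + (of_real (f 1) + \<i> * of_real (f \<i>)) / 2 * fourier_exp (- 1) x" for x
  proof -
    define w where "w = fourier_exp 1 x"
    have "w = Re w *\<^sub>R 1 + Im w *\<^sub>R \<i>"
      by (simp add: complex_eq_iff)
    then have "f w = Re w * f 1 + Im w * f \<i>"
      by (metis add scaleR real_scaleR_def)
    then have "of_real (f w) = (of_real (f 1) - \<i> * of_real (f \<i>)) / 2 * w
      + (of_real (f 1) + \<i> * of_real (f \<i>)) / 2 * cnj w"
      by (simp add: complex_eq_iff field_simps)
    then show ?thesis by (simp add: w_def cnj_fourier_exp)
  qed
  then show ?case
    by (simp only:) (intro trig_polynomial.intros)
next
  case (const c)
  show ?case using trig_polynomial.monomial[of "of_real c" 0] by simp
next
  case (add f g)
  then show ?case using trig_polynomial.add[OF add.IH] by simp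
next
  case (mult f g)
  then show ?case using trig_polynomial_mult[OF mult.IH] by simp
qed

text \<open>A continuous function with equal values at \<open>0\<close> and \<open>1\<close> is a continuous function on the unit
  circle, where Stone--Weierstrass applies.\<close>

lemma trig_polynomial_dense:
  assumes h: "continuous_on {0..1} h" "h 0 = h 1" and "e > 0"
  obtains p where "trig_polynomial p" "\<And>x. x \<in> {0..1} \<Longrightarrow> cmod (h x - p x) < e"
proof -
  \<comment> \<open>\<open>Arg2pi z / (2 * pi)\<close> maps the circle to [0,1) with a jump at the
    point 1. The condition \<open>h 0 = h 1\<close> removes the jump from \<open>F\<close>; the
    homotopy of \<open>h\<close> with itself serves to extract this continuity.\<close>
  define F where "F = h \<circ> (\<lambda>z. Arg2pi z / (2 * pi))"
  have "homotopic_loops UNIV h h"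
    using h by (simp add: homotopic_loops_refl path_def pathstart_def pathfinish_def)
  then have "continuous_on (sphere 0 1) F"
    unfolding F_def
    using homotopic_loops_imp_homotopic_circlemaps homotopic_with_imp_continuous by blast
  then obtain g where g: "polynomial_function g" "\<And>w. w \<in> sphere 0 1 \<Longrightarrow> cmod (F w - g w) < e"
    using Stone_Weierstrass_polynomial_function[of "sphere 0 1" F e] \<open>e > 0\<close> by auto
  have F: "F (fourier_exp 1 x) = h x" if "x \<in> {0..1}" for x
  proof (cases "x = 1")
    case True
    \<comment> \<open>The endpoint 1 lands on the circle point of argument 0, so \<open>F\<close>
      returns \<open>h 0\<close>, which equals \<open>h 1\<close>.\<close>
    then show ?thesis using h Arg2pi_exp[of 0] by (simp add: F_def)
  next
    case False
    then have "Arg2pi (fourier_exp 1 x) = 2 * pi * x"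
      unfolding fourier_exp_def using that by (subst Arg2pi_exp) auto
    then show ?thesis by (simp add: F_def)
  qed
  \<comment> \<open>\<open>g\<close> is complex-valued, whereas the passage to exponentials is for
    real polynomials; its real and imaginary parts are converted separately.\<close>
  define p where "p = (\<lambda>x. of_real (Re (g (fourier_exp 1 x))) + \<i> * of_real (Im (g (fourier_exp 1 x))))"
  show thesis
  proof
    have "real_polynomial_function (Re \<circ> g)" "real_polynomial_function (Im \<circ> g)"
      using g(1) by (auto simp: polynomial_function_def bounded_linear_Re bounded_linear_Im)
    from this[THEN trig_polynomial_real_polynomial] show "trig_polynomial p"
      using trig_polynomial_mult[OF trig_polynomial.monomial[of \<i> 0]]
      unfolding p_def o_def by (intro trig_polynomial.add) auto
    fix x :: real assume "x \<in> {0..1}"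
    moreover have "p x = g (fourier_exp 1 x)"
      by (simp add: p_def complex_eq_iff)
    moreover have "cmod (fourier_exp 1 x) = 1"
      by (simp add: fourier_exp_def)
    ultimately show "cmod (h x - p x) < e"
      using g(2)[of "fourier_exp 1 x"] F[of x] by simp
  qed
qed

section \<open>Completeness of the exponentials by successive approximation\<close>

lemma has_fourier_series_periodic:
  assumes h: "continuous_on {0..1} h" "h 0 = h 1"
  shows "has_fourier_series (abs_l2 h)"
proof -
  have "\<exists>p. trig_polynomial p \<and> (\<forall>x\<in>{0..1}. cmod (h x - p x) < 1 / Suc i)" for i
    using trig_polynomial_dense[OF h, of "1 / Suc i"] by (metis of_nat_0_less_iff zero_less_Suc zero_less_divide_1_iff)
  then obtain p where p: "\<And>i. trig_polynomial (p i)"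
      "\<And>i x. x \<in> {0..1} \<Longrightarrow> cmod (h x - p i x) < 1 / Suc i"
    by metis
  have sq: "sq_integrable (p i)" "sq_integrable h" for i
    using p(1) h by (auto intro: sq_integrable_continuous continuous_on_trig_polynomial)
  have "norm (abs_l2 (p i) - abs_l2 h) \<le> 1 / Suc i" for i
    unfolding diff_abs_l2[OF sq]
    by (rule norm_abs_l2_le[OF sq_integrable_diff[OF sq]])
      (use p(2) in \<open>auto simp: norm_minus_commute intro!: less_imp_le\<close>)
  then have "(\<lambda>i. abs_l2 (p i) - abs_l2 h) \<longlonglongrightarrow> 0"
    by (rule Lim_null_comparison[OF always_eventually[OF allI]])
      (rule LIMSEQ_Suc[OF lim_1_over_n])
  then show ?thesis
    using has_fourier_series_limit[of "\<lambda>i. abs_l2 (p i)"] has_fourier_series_trig_polynomial p(1)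
    by (simp add: LIM_zero_iff)
qed

lemma has_fourier_series_continuous_bounded:
  assumes h: "continuous_on UNIV h" "\<And>x. cmod (h x) \<le> B"
  shows "has_fourier_series (abs_l2 h)"
proof -
  \<comment> \<open>On [0,1] the factor vanishes at both ends, lies between 0 and 1, and for
    positive \<open>k\<close> equals 1 wherever the distance to the boundary is at least
    \<open>1 / k\<close>. So \<open>s k\<close> has equal boundary values and is still bounded by
    \<open>B\<close>.\<close>
  define s where "s = (\<lambda>(k::nat) x. of_real (min 1 (real k * min x (1 - x))) * h x)"
  have cont: "continuous_on S (s k)" for k S
    unfolding s_def by (intro continuous_intros continuous_on_subset[OF h(1)]) auto
  have "(\<lambda>i. abs_l2 (s i)) \<longlonglongrightarrow> abs_l2 h"
  proof (rule tendsto_abs_l2(3))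
    interpret finite_measure leb01 by (rule finite_measure_leb01)
    show "integrable leb01 (\<lambda>x. B\<^sup>2)" by simp
    show "h \<in> borel_measurable leb01" "s i \<in> borel_measurable leb01" for i
      by (auto intro!: continuous_imp_measurable_on_sets_lebesgue cont continuous_on_subset[OF h(1)])
    show "AE x in leb01. (\<lambda>i. s i x) \<longlonglongrightarrow> h x"
    proof (rule AE_leb01I)
      fix x :: real assume "0 < x" "x < 1"
      then have "0 < min x (1 - x)" by simp
      then obtain N where N: "1 < real N * min x (1 - x)"
        using reals_Archimedean3 by metis
      have "s i x = h x" if "i \<ge> N" for i
      proof -
        have "real N * min x (1 - x) \<le> real i * min x (1 - x)"
          using that \<open>0 < min x (1 - x)\<close> by (intro mult_right_mono) auto
        then show ?thesis using N by (simp add: s_def)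
      qed
      then show "(\<lambda>i. s i x) \<longlonglongrightarrow> h x"
        by (intro tendsto_eventually eventually_sequentiallyI[of N])
    qed
    show "AE x in leb01. cmod (s i x) \<le> B" for i
    proof (rule AE_leb01I)
      fix x :: real assume "0 < x" "x < 1"
      then have "\<bar>min 1 (real i * min x (1 - x))\<bar> \<le> 1"
        by (auto simp: abs_le_iff min_def)
      then show "cmod (s i x) \<le> B"
        using mult_mono[of "\<bar>min 1 (real i * min x (1 - x))\<bar>" 1 "cmod (h x)" B] h(2)[of x]
        unfolding s_def norm_mult norm_of_real by simp
    qed
  qed
  moreover have "has_fourier_series (abs_l2 (s i))" for i
    by (intro has_fourier_series_periodic cont) (simp add: s_def)
  ultimately show ?thesis by (rule has_fourier_series_limit)
qed

lemma has_fourier_series_bounded: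
  assumes [measurable]: "f \<in> borel_measurable leb01" and B: "\<And>x. cmod (f x) \<le> B"
  shows "has_fourier_series (abs_l2 f)"
proof -
  have "f measurable_on {0<..<1}"
    by (subst measurable_on_iff_borel_measurable) auto
  then obtain N g where N: "negligible N" and g: "\<And>n. continuous_on UNIV (g n)"
    and lim: "\<And>x. x \<notin> N \<Longrightarrow> (\<lambda>n. g n x) \<longlonglongrightarrow> (if x \<in> {0<..<1} then f x else 0)"
    unfolding measurable_on_def by blast
  have "0 \<le> B" using B[of 0] norm_ge_zero order_trans by blast
  \<comment> \<open>The continuous functions \<open>g n\<close> need not be bounded. Projecting
    their values onto the ball of radius \<open>B\<close> gives a common bound, keeps continuity,
    and does not change the limit, since the values of \<open>f\<close> already lie in the
    ball.\<close>
  define r where "r = closest_point (cball (0::complex) B)"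
  have r: "continuous_on UNIV r" "cmod (r w) \<le> B" "cmod w \<le> B \<Longrightarrow> r w = w" for w
    using closest_point_in_set[of "cball (0::complex) B" w] \<open>0 \<le> B\<close> continuous_on_closest_point[of "cball (0::complex) B"]
    by (auto simp: r_def closest_point_self)
  have cont: "continuous_on S (\<lambda>x. r (g n x))" for n S
    using continuous_on_compose2[OF r(1) g] continuous_on_subset by blast
  have "(\<lambda>n. abs_l2 (\<lambda>x. r (g n x))) \<longlonglongrightarrow> abs_l2 f"
  proof (rule tendsto_abs_l2(3))
    interpret finite_measure leb01 by (rule finite_measure_leb01)
    show "integrable leb01 (\<lambda>x. B\<^sup>2)" by simp
    show "(\<lambda>x. r (g i x)) \<in> borel_measurable leb01" for i
      by (auto intro!: continuous_imp_measurable_on_sets_lebesgue cont)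
    have "AE x in lebesgue. x \<notin> N"
      using N by (auto simp: eventually_ae_filter_negligible)
    then show "AE x in leb01. (\<lambda>i. r (g i x)) \<longlonglongrightarrow> f x"
      unfolding AE_leb01_iff
    proof eventually_elim
      case (elim x)
      show ?case
      proof
        assume "x \<in> {0<..<1}"
        then have "(\<lambda>n. g n x) \<longlonglongrightarrow> f x" using lim[OF elim] by simp
        then have "(\<lambda>i. r (g i x)) \<longlonglongrightarrow> r (f x)"
          using r(1) by (intro isCont_tendsto_compose[of _ r]) (auto simp: continuous_on_eq_continuous_at)
        then show "(\<lambda>i. r (g i x)) \<longlonglongrightarrow> f x" using r(3)[OF B] by simp
      qed
    qed
  qed (use r in auto)
  moreover have "has_fourier_series (abs_l2 (\<lambda>x. r (g n x)))" for n
    using has_fourier_series_continuous_bounded[OF cont r(2)] .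
  ultimately show ?thesis by (rule has_fourier_series_limit)
qed

theorem has_fourier_series_l2: "has_fourier_series f"
proof -
  obtain h where h: "sq_integrable h" and f: "f = abs_l2 h" by (rule l2_cases)
  have [measurable]: "h \<in> borel_measurable leb01" using h by (simp add: sq_integrable_def)
  \<comment> \<open>Large values are cut to 0, so \<open>s k\<close> is bounded by \<open>k\<close>,
    while \<open>cmod (h x)\<close> dominates the whole sequence.\<close>
  define s where "s = (\<lambda>(k::nat) x. if cmod (h x) \<le> real k then h x else 0)"
  have meas: "s k \<in> borel_measurable leb01" for k
    unfolding s_def by measurable
  have "(\<lambda>i. abs_l2 (s i)) \<longlonglongrightarrow> abs_l2 h"
  proof (rule tendsto_abs_l2(3))
    show "integrable leb01 (\<lambda>x. (cmod (h x))\<^sup>2)" using h by (simp add: sq_integrable_def)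
    show "AE x in leb01. (\<lambda>i. s i x) \<longlonglongrightarrow> h x"
    proof (rule AE_leb01I)
      fix x
      obtain N :: nat where "cmod (h x) \<le> N" using real_arch_simple by blast
      then show "(\<lambda>i. s i x) \<longlonglongrightarrow> h x"
        by (intro tendsto_eventually eventually_sequentiallyI[of N]) (auto simp: s_def)
    qed
  qed (use meas in \<open>auto simp: s_def\<close>)
  moreover have "has_fourier_series (abs_l2 (s i))" for i
    by (rule has_fourier_series_bounded[OF meas, of _ "real i"]) (simp add: s_def)
  ultimately show ?thesis unfolding f by (rule has_fourier_series_limit)
qed

section \<open>The differential operator\<close>

text \<open>This makes the definite description in \<open>third_deriv\<close> meaningful. Equality
  passes from the continuous representatives to each derivative in turn on the open interval, and to
  the last one almost everywhere.\<close>

lemma has_derivs3_unique: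
  assumes "has_derivs3 y h0 h1 h2 w" "has_derivs3 y g0 g1 g2 w'"
  shows "w = w'"
proof -
  \<comment> \<open>A derivative at an interior point depends only on the values in the open
    interval, so the endpoints need no care.\<close>
  have transfer_deriv: "b x = b' x"
    if ab: "(a has_vector_derivative b x) (at x within {0..1})"
           "(a' has_vector_derivative b' x) (at x within {0..1})"
      and eq: "\<And>t. t \<in> {0<..<1} \<Longrightarrow> a t = a' t" and x: "x \<in> {0<..<1}"
    for a a' b b' :: "real \<Rightarrow> complex" and x
  proof -
    have at: "at x within {0..1} = at x"
      using x by (intro at_within_interior) auto
    have "(a' has_vector_derivative b x) (at x)"
      using ab(1) unfolding at
      by (rule has_vector_derivative_transform_within_open[where S="{0<..<1}"]) (use eq x in auto)
    then show ?thesis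
      using ab(2) unfolding at by (rule vector_derivative_unique_at)
  qed
  have sq: "sq_integrable h0" "sq_integrable g0"
    and d: "\<And>x. x \<in> {0..1} \<Longrightarrow> (h0 has_vector_derivative h1 x) (at x within {0..1})"
      "\<And>x. x \<in> {0..1} \<Longrightarrow> (g0 has_vector_derivative g1 x) (at x within {0..1})"
      "\<And>x. x \<in> {0..1} \<Longrightarrow> (h1 has_vector_derivative h2 x) (at x within {0..1})"
      "\<And>x. x \<in> {0..1} \<Longrightarrow> (g1 has_vector_derivative g2 x) (at x within {0..1})"
    and y: "abs_l2 h0 = abs_l2 g0"
    using assms by (auto simp: has_derivs3_def)
  obtain h3 where h3: "AE x in leb01. (h2 has_vector_derivative h3 x) (at x)"
      "sq_integrable h3" "w = abs_l2 h3"
    using assms(1) by (auto simp: has_derivs3_def)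
  obtain g3 where g3: "AE x in leb01. (g2 has_vector_derivative g3 x) (at x)"
      "sq_integrable g3" "w' = abs_l2 g3"
    using assms(2) by (auto simp: has_derivs3_def)
  have eq0: "h0 x = g0 x" if "x \<in> {0<..<1}" for x
  proof -
    have "continuous_on {0..1} h0" "continuous_on {0..1} g0"
      using has_vector_derivative_continuous[OF d(1)] has_vector_derivative_continuous[OF d(2)]
      by (simp_all add: continuous_on_eq_continuous_within)
    then have "continuous_on {0<..<1} (\<lambda>x. h0 x - g0 x)"
      by (intro continuous_intros) (auto elim: continuous_on_subset)
    \<comment> \<open>Equality of classes makes the set where the continuous representatives differ
      negligible. It is also open, and a nonempty open set is not negligible.\<close>
    then have "open ({0<..<1} \<inter> (\<lambda>x. h0 x - g0 x) -` (- {0}))"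
      by (intro continuous_open_preimage) auto
    moreover have "negligible ({0<..<1} \<inter> (\<lambda>x. h0 x - g0 x) -` (- {0}))"
    proof -
      have "AE x in lebesgue. x \<in> {0<..<1} \<longrightarrow> h0 x = g0 x"
        using y abs_l2_eq_iff[OF sq] by (simp add: AE_leb01_iff)
      then obtain N where "negligible N" "{x. \<not> (x \<in> {0<..<1} \<longrightarrow> h0 x = g0 x)} \<subseteq> N"
        unfolding eventually_ae_filter_negligible by blast
      then show ?thesis
        by (elim negligible_subset) auto
    qed
    ultimately have "{0<..<1} \<inter> (\<lambda>x. h0 x - g0 x) -` (- {0}) = {}"
      using open_not_negligible by blast
    then show ?thesis using that by auto
  qed
  have eq1: "h1 x = g1 x" if "x \<in> {0<..<1}" for x
    by (rule transfer_deriv[where a=h0 and a'=g0]) (use d eq0 that in auto)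
  have eq2: "h2 x = g2 x" if "x \<in> {0<..<1}" for x
    by (rule transfer_deriv[where a=h1 and a'=g1]) (use d eq1 that in auto)
  have "AE x in leb01. h3 x = g3 x"
    using h3(1) g3(1) unfolding AE_leb01_iff
  proof eventually_elim
    case (elim x)
    show ?case
    proof
      assume x: "x \<in> {0<..<1}"
      show "h3 x = g3 x"
        by (rule transfer_deriv[where a=h2 and a'=g2])
          (use elim eq2 x in \<open>auto intro: has_vector_derivative_at_within\<close>)
    qed
  qed
  then show ?thesis
    using h3 g3 by (simp add: abs_l2_eq_iff)
qed

lemma third_deriv_eq: "has_derivs3 y h0 h1 h2 w \<Longrightarrow> third_deriv y = w"
  unfolding third_deriv_def by (rule the_equality) (auto intro: has_derivs3_unique)

section \<open>Absolute continuity and linearity of the third derivative\<close>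

lemma abs_cont_on_add:
  assumes "abs_cont_on a b f" "abs_cont_on a b g"
  shows "abs_cont_on a b (\<lambda>x. f x + g x)"
  unfolding abs_cont_on_def
proof (intro allI impI)
  fix e :: real assume "e > 0"
  then have "e / 2 > 0" by simp
  then obtain d1 where d1: "d1 > 0"
    "\<And>I. finite I \<and> (\<forall>(s, t)\<in>I. a \<le> s \<and> s \<le> t \<and> t \<le> b) \<and>
      disjoint_family_on (\<lambda>(s, t). {s<..<t}) I \<and> (\<Sum>(s, t)\<in>I. t - s) < d1 \<Longrightarrow>
      (\<Sum>(s, t)\<in>I. cmod (f t - f s)) < e / 2"
    using assms(1)[unfolded abs_cont_on_def, rule_format, of "e / 2"] by blast
  from \<open>e / 2 > 0\<close> obtain d2 where d2: "d2 > 0"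
    "\<And>I. finite I \<and> (\<forall>(s, t)\<in>I. a \<le> s \<and> s \<le> t \<and> t \<le> b) \<and>
      disjoint_family_on (\<lambda>(s, t). {s<..<t}) I \<and> (\<Sum>(s, t)\<in>I. t - s) < d2 \<Longrightarrow>
      (\<Sum>(s, t)\<in>I. cmod (g t - g s)) < e / 2"
    using assms(2)[unfolded abs_cont_on_def, rule_format, of "e / 2"] by blast
  show "\<exists>\<delta>>0. \<forall>I. finite I \<and> (\<forall>(s, t)\<in>I. a \<le> s \<and> s \<le> t \<and> t \<le> b) \<and>
      disjoint_family_on (\<lambda>(s, t). {s<..<t}) I \<and> (\<Sum>(s, t)\<in>I. t - s) < \<delta> \<longrightarrow>
      (\<Sum>(s, t)\<in>I. cmod (f t + g t - (f s + g s))) < e"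
  proof (intro exI[of _ "min d1 d2"] conjI allI impI)
    show "min d1 d2 > 0" using d1 d2 by simp
    fix I :: "(real \<times> real) set"
    assume I: "finite I \<and> (\<forall>(s, t)\<in>I. a \<le> s \<and> s \<le> t \<and> t \<le> b) \<and>
      disjoint_family_on (\<lambda>(s, t). {s<..<t}) I \<and> (\<Sum>(s, t)\<in>I. t - s) < min d1 d2"
    have "(\<Sum>(s, t)\<in>I. cmod (f t + g t - (f s + g s)))
        \<le> (\<Sum>(s, t)\<in>I. cmod (f t - f s) + cmod (g t - g s))"
      by (intro sum_mono) (auto simp: add_diff_add norm_triangle_ineq)
    also have "\<dots> = (\<Sum>(s, t)\<in>I. cmod (f t - f s)) + (\<Sum>(s, t)\<in>I. cmod (g t - g s))"
      by (simp add: case_prod_unfold sum.distrib)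
    also have "\<dots> < e"
      using d1(2)[of I] d2(2)[of I] I by simp
    finally show "(\<Sum>(s, t)\<in>I. cmod (f t + g t - (f s + g s))) < e" .
  qed
qed

text \<open>Comparing increments covers two cases at once: scalar multiples, and Lipschitz functions
  compared with the embedding \<open>of_real\<close>.\<close>

lemma abs_cont_on_compose_lipschitz:
  assumes "abs_cont_on a b f"
    and L: "\<And>s t. s \<in> {a..b} \<Longrightarrow> t \<in> {a..b} \<Longrightarrow> cmod (g t - g s) \<le> L * cmod (f t - f s)"
  shows "abs_cont_on a b g"
  unfolding abs_cont_on_def
proof (intro allI impI)
  fix e :: real assume "e > 0"
  \<comment> \<open>\<open>L\<close> may be 0, as for a zero scalar or the constant exponential; the
    maximum makes division by it safe.\<close>
  define L' where "L' = max L 1"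
  have "L' > 0" by (simp add: L'_def)
  then have "e / L' > 0" using \<open>e > 0\<close> by simp
  then obtain d where d: "d > 0"
    "\<And>I. finite I \<and> (\<forall>(s, t)\<in>I. a \<le> s \<and> s \<le> t \<and> t \<le> b) \<and>
      disjoint_family_on (\<lambda>(s, t). {s<..<t}) I \<and> (\<Sum>(s, t)\<in>I. t - s) < d \<Longrightarrow>
      (\<Sum>(s, t)\<in>I. cmod (f t - f s)) < e / L'"
    using assms(1)[unfolded abs_cont_on_def, rule_format, of "e / L'"] by blast
  show "\<exists>\<delta>>0. \<forall>I. finite I \<and> (\<forall>(s, t)\<in>I. a \<le> s \<and> s \<le> t \<and> t \<le> b) \<and>
      disjoint_family_on (\<lambda>(s, t). {s<..<t}) I \<and> (\<Sum>(s, t)\<in>I. t - s) < \<delta> \<longrightarrow>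
      (\<Sum>(s, t)\<in>I. cmod (g t - g s)) < e"
  proof (intro exI[of _ d] conjI allI impI)
    fix I :: "(real \<times> real) set"
    assume I: "finite I \<and> (\<forall>(s, t)\<in>I. a \<le> s \<and> s \<le> t \<and> t \<le> b) \<and>
      disjoint_family_on (\<lambda>(s, t). {s<..<t}) I \<and> (\<Sum>(s, t)\<in>I. t - s) < d"
    have "(\<Sum>(s, t)\<in>I. cmod (g t - g s)) \<le> (\<Sum>(s, t)\<in>I. L' * cmod (f t - f s))"
    proof (intro sum_mono, clarify)
      fix s t assume "(s, t) \<in> I"
      then have "s \<in> {a..b}" "t \<in> {a..b}" using I by fastforce+
      then have "cmod (g t - g s) \<le> L * cmod (f t - f s)" by (rule L)
      also have "\<dots> \<le> L' * cmod (f t - f s)"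
        by (intro mult_right_mono) (auto simp: L'_def)
      finally show "cmod (g t - g s) \<le> L' * cmod (f t - f s)" .
    qed
    also have "\<dots> = L' * (\<Sum>(s, t)\<in>I. cmod (f t - f s))"
      by (simp add: case_prod_unfold sum_distrib_left)
    also have "\<dots> < L' * (e / L')"
      using d(2)[OF I] \<open>L' > 0\<close> by (rule mult_strict_left_mono)
    also have "\<dots> = e" using \<open>L' > 0\<close> by simp
    finally show "(\<Sum>(s, t)\<in>I. cmod (g t - g s)) < e" .
  qed (use d in auto)
qed

lemma abs_cont_on_cmult:
  "abs_cont_on a b f \<Longrightarrow> abs_cont_on a b (\<lambda>x. c * f x)"
  by (erule abs_cont_on_compose_lipschitz[where L="cmod c"])
    (simp add: norm_mult flip: right_diff_distrib)

lemma abs_cont_on_of_real: "abs_cont_on a b of_real"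
  unfolding abs_cont_on_def
proof (intro allI impI exI conjI)
  fix e :: real and I :: "(real \<times> real) set"
  assume I: "finite I \<and> (\<forall>(s, t)\<in>I. a \<le> s \<and> s \<le> t \<and> t \<le> b) \<and>
      disjoint_family_on (\<lambda>(s, t). {s<..<t}) I \<and> (\<Sum>(s, t)\<in>I. t - s) < e"
  have "(\<Sum>(s, t)\<in>I. cmod (of_real t - of_real s)) = (\<Sum>(s, t)\<in>I. t - s)"
    using I by (intro sum.cong) (auto simp flip: of_real_diff)
  then show "(\<Sum>(s, t)\<in>I. cmod (of_real t - of_real s)) < e" using I by simp
qed

lemma has_derivs3_add:
  assumes "has_derivs3 y h0 h1 h2 w" "has_derivs3 y' g0 g1 g2 w'"
  shows "has_derivs3 (y + y') (\<lambda>x. h0 x + g0 x) (\<lambda>x. h1 x + g1 x) (\<lambda>x. h2 x + g2 x) (w + w')"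
proof -
  obtain h3 where h3: "AE x in leb01. (h2 has_vector_derivative h3 x) (at x)"
      "sq_integrable h3" "w = abs_l2 h3"
    using assms(1) by (auto simp: has_derivs3_def)
  obtain g3 where g3: "AE x in leb01. (g2 has_vector_derivative g3 x) (at x)"
      "sq_integrable g3" "w' = abs_l2 g3"
    using assms(2) by (auto simp: has_derivs3_def)
  have "AE x in leb01. ((\<lambda>x. h2 x + g2 x) has_vector_derivative h3 x + g3 x) (at x)"
    using h3(1) g3(1) by eventually_elim (rule has_vector_derivative_add)
  moreover have "sq_integrable (\<lambda>x. h3 x + g3 x)" "w + w' = abs_l2 (\<lambda>x. h3 x + g3 x)"
    using h3 g3 by (simp_all add: add_abs_l2 sq_integrable_add)
  ultimately show ?thesis
    using assms unfolding has_derivs3_def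
    by (intro conjI exI[of _ "\<lambda>x. h3 x + g3 x"])
      (simp_all add: add_abs_l2 sq_integrable_add has_vector_derivative_add abs_cont_on_add)
qed

lemma has_derivs3_scaleC:
  assumes "has_derivs3 y h0 h1 h2 w"
  shows "has_derivs3 (c *\<^sub>C y) (\<lambda>x. c * h0 x) (\<lambda>x. c * h1 x) (\<lambda>x. c * h2 x) (c *\<^sub>C w)"
proof -
  obtain h3 where h3: "AE x in leb01. (h2 has_vector_derivative h3 x) (at x)"
      "sq_integrable h3" "w = abs_l2 h3"
    using assms(1) by (auto simp: has_derivs3_def)
  have "AE x in leb01. ((\<lambda>x. c * h2 x) has_vector_derivative c * h3 x) (at x)"
    using h3(1) by eventually_elim (rule has_vector_derivative_mult_right)
  moreover have "sq_integrable (\<lambda>x. c * h3 x)" "c *\<^sub>C w = abs_l2 (\<lambda>x. c * h3 x)"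
    using h3 by (simp_all add: scaleC_abs_l2 sq_integrable_scale)
  ultimately show ?thesis
    using assms unfolding has_derivs3_def
    by (intro conjI exI[of _ "\<lambda>x. c * h3 x"])
      (simp_all add: scaleC_abs_l2 sq_integrable_scale has_vector_derivative_mult_right abs_cont_on_cmult)
qed

lemma L_domE:
  assumes "y \<in> L_dom"
  obtains h0 h1 h2 where "has_derivs3 y h0 h1 h2 (third_deriv y)" "h0 1 = h0 0" "h1 1 = h1 0" "h2 1 = h2 0"
  using assms unfolding L_dom_def by (auto dest: third_deriv_eq)

lemma L_domI:
  "has_derivs3 y h0 h1 h2 w \<Longrightarrow> h0 1 = h0 0 \<Longrightarrow> h1 1 = h1 0 \<Longrightarrow> h2 1 = h2 0 \<Longrightarrow> y \<in> L_dom"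
  unfolding L_dom_def by blast

lemma L_dom_add:
  assumes "y \<in> L_dom" "y' \<in> L_dom"
  shows "y + y' \<in> L_dom" "third_deriv (y + y') = third_deriv y + third_deriv y'"
proof -
  obtain h0 h1 h2 where h: "has_derivs3 y h0 h1 h2 (third_deriv y)"
      "h0 1 = h0 0" "h1 1 = h1 0" "h2 1 = h2 0"
    using assms(1) by (rule L_domE)
  obtain g0 g1 g2 where g: "has_derivs3 y' g0 g1 g2 (third_deriv y')"
      "g0 1 = g0 0" "g1 1 = g1 0" "g2 1 = g2 0"
    using assms(2) by (rule L_domE)
  note sum = has_derivs3_add[OF h(1) g(1)]
  show "y + y' \<in> L_dom"
    by (rule L_domI[OF sum]) (simp_all add: h g)
  show "third_deriv (y + y') = third_deriv y + third_deriv y'"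
    by (rule third_deriv_eq[OF sum])
qed

lemma L_dom_scaleC:
  assumes "y \<in> L_dom"
  shows "c *\<^sub>C y \<in> L_dom" "third_deriv (c *\<^sub>C y) = c *\<^sub>C third_deriv y"
proof -
  obtain h0 h1 h2 where h: "has_derivs3 y h0 h1 h2 (third_deriv y)"
      "h0 1 = h0 0" "h1 1 = h1 0" "h2 1 = h2 0"
    using assms by (rule L_domE)
  note scaled = has_derivs3_scaleC[OF h(1), of c]
  show "c *\<^sub>C y \<in> L_dom"
    by (rule L_domI[OF scaled]) (simp_all add: h)
  show "third_deriv (c *\<^sub>C y) = c *\<^sub>C third_deriv y"
    by (rule third_deriv_eq[OF scaled])
qed

section \<open>The exponentials as eigenfunctions\<close>

lemma fourier_exp_lipschitz:
  "cmod (fourier_exp n t - fourier_exp n s) \<le> cmod (2 * of_int n * of_real pi * \<i>) * cmod (of_real t - of_real s)"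
proof -
  have "norm (fourier_exp n t - fourier_exp n s) \<le> cmod (2 * of_int n * of_real pi * \<i>) * norm (t - s)"
  proof (rule differentiable_bound[of UNIV _ "\<lambda>x y. y *\<^sub>R (2 * of_int n * of_real pi * \<i> * fourier_exp n x)"])
    show "(fourier_exp n has_derivative (\<lambda>y. y *\<^sub>R (2 * of_int n * of_real pi * \<i> * fourier_exp n x))) (at x within UNIV)" for x
      using fourier_exp_has_vector_derivative by (simp add: has_vector_derivative_def)
    show "onorm (\<lambda>y. y *\<^sub>R (2 * of_int n * of_real pi * \<i> * fourier_exp n x)) \<le> cmod (2 * of_int n * of_real pi * \<i>)" for x
      by (rule onorm_bound) (auto simp: norm_mult fourier_exp_def)
  qed auto
  then show ?thesis by (simp flip: of_real_diff)
qed

lemma has_derivs3_eigfun: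
  fixes n :: int
  defines "c \<equiv> 2 * of_int n * of_real pi * \<i>"
  shows "has_derivs3 (eigfun n) (fourier_exp n) (\<lambda>x. c * fourier_exp n x) (\<lambda>x. c\<^sup>2 * fourier_exp n x) (c ^ 3 *\<^sub>C eigfun n)"
proof -
  have D: "(fourier_exp n has_vector_derivative c * fourier_exp n x) (at x within S)" for x S
    unfolding c_def by (rule fourier_exp_has_vector_derivative)
  have "abs_cont_on 0 1 (fourier_exp n)"
    using abs_cont_on_of_real fourier_exp_lipschitz by (rule abs_cont_on_compose_lipschitz)
  moreover have "((\<lambda>x. c * fourier_exp n x) has_vector_derivative c\<^sup>2 * fourier_exp n x) (at x within S)" for x S
    using has_vector_derivative_mult_right[OF D, of c] by (simp add: power2_eq_square mult.assoc)
  moreover have "((\<lambda>x. c\<^sup>2 * fourier_exp n x) has_vector_derivative c ^ 3 * fourier_exp n x) (at x within S)" for x S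
    using has_vector_derivative_mult_right[OF D, of "c\<^sup>2"] by (simp add: power2_eq_square power3_eq_cube mult.assoc)
  ultimately show ?thesis
    unfolding has_derivs3_def
    using D sq_integrable_fourier_exp
    by (auto simp: eigfun_eq scaleC_abs_l2 intro!: abs_cont_on_cmult sq_integrable_scale
        exI[of _ "\<lambda>x. c ^ 3 * fourier_exp n x"])
qed

lemma eigfun_in_L_dom: "eigfun n \<in> L_dom"
  by (rule L_domI[OF has_derivs3_eigfun]) simp_all

lemma L_op_0_eigfun: "snd (L_op 0 v) (eigfun n) = eigval n *\<^sub>C eigfun n"
proof -
  \<comment> \<open>Three derivatives contribute \<open>\<i> ^ 3\<close> and the operator one more
    \<open>\<i>\<close>, so the eigenvalue is a real cube.\<close>
  have "\<i> * (c * \<i>) ^ 3 = c ^ 3" for c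
    by (simp add: power3_eq_cube mult_ac)
  then show ?thesis
    unfolding L_op_def by (simp add: third_deriv_eq[OF has_derivs3_eigfun] scaleC_scaleC eigval_def)
qed

lemma L_op_add:
  "y \<in> L_dom \<Longrightarrow> y' \<in> L_dom \<Longrightarrow> snd (L_op \<alpha> v) (y + y') = snd (L_op \<alpha> v) y + snd (L_op \<alpha> v) y'"
  by (simp add: L_op_def L_dom_add scaleC_add_right cinner_add_left scaleC_add_left algebra_simps)

lemma L_op_scaleC:
  "y \<in> L_dom \<Longrightarrow> snd (L_op \<alpha> v) (c *\<^sub>C y) = c *\<^sub>C snd (L_op \<alpha> v) y"
  by (simp add: L_op_def L_dom_scaleC scaleC_add_right cinner_scaleC_left scaleC_scaleC mult_ac)

lemma L_op_eq_L_op_0: "snd (L_op \<alpha> v) y = snd (L_op 0 v) y + (\<alpha> * \<langle>y, v\<rangle>) *\<^sub>C v"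
  by (simp add: L_op_def)

lemma fst_L_op [simp]: "fst (L_op \<alpha> v) = L_dom"
  by (simp add: L_op_def)

section \<open>Resolvents\<close>

text \<open>Arbitrary \<alpha> lets the same facts serve the unperturbed and the perturbed
  operator.\<close>

context
  fixes \<alpha> :: real and v :: l2 and z :: complex
  assumes z: "z \<notin> spectrum (L_op \<alpha> v)"
begin

lemma resolvent_in_L_dom: "resolvent (L_op \<alpha> v) z f \<in> L_dom"
  and resolvent_right_inverse:
    "snd (L_op \<alpha> v) (resolvent (L_op \<alpha> v) z f) - z *\<^sub>C resolvent (L_op \<alpha> v) z f = f"
proof -
  have "f \<in> (\<lambda>y. snd (L_op \<alpha> v) y - z *\<^sub>C y) ` L_dom"
    using z by (auto simp: spectrum_def resolvent_set_def bij_betw_def)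
  from inv_into_into[OF this] f_inv_into_f[OF this]
  show "resolvent (L_op \<alpha> v) z f \<in> L_dom"
    "snd (L_op \<alpha> v) (resolvent (L_op \<alpha> v) z f) - z *\<^sub>C resolvent (L_op \<alpha> v) z f = f"
    by (simp_all add: resolvent_def)
qed

text \<open>Injectivity of the shifted operator. Every later computation of a resolvent exhibits a
  candidate in the domain and checks the equation.\<close>

lemma resolvent_eqI:
  assumes "y \<in> L_dom" "snd (L_op \<alpha> v) y - z *\<^sub>C y = f"
  shows "resolvent (L_op \<alpha> v) z f = y"
  using z assms inv_into_f_f[of "\<lambda>y. snd (L_op \<alpha> v) y - z *\<^sub>C y" L_dom y]
  by (auto simp: spectrum_def resolvent_set_def bij_betw_def resolvent_def)

lemma resolvent_add:
  "resolvent (L_op \<alpha> v) z (f + g) = resolvent (L_op \<alpha> v) z f + resolvent (L_op \<alpha> v) z g"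
proof (rule resolvent_eqI)
  let ?R = "resolvent (L_op \<alpha> v) z"
  show "?R f + ?R g \<in> L_dom"
    by (intro L_dom_add resolvent_in_L_dom)
  have "snd (L_op \<alpha> v) (?R f + ?R g) - z *\<^sub>C (?R f + ?R g)
      = (snd (L_op \<alpha> v) (?R f) - z *\<^sub>C ?R f) + (snd (L_op \<alpha> v) (?R g) - z *\<^sub>C ?R g)"
    by (simp add: L_op_add resolvent_in_L_dom scaleC_add_right)
  then show "snd (L_op \<alpha> v) (?R f + ?R g) - z *\<^sub>C (?R f + ?R g) = f + g"
    by (simp only: resolvent_right_inverse)
qed

lemma resolvent_scaleC:
  "resolvent (L_op \<alpha> v) z (c *\<^sub>C f) = c *\<^sub>C resolvent (L_op \<alpha> v) z f"
proof (rule resolvent_eqI)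
  let ?R = "resolvent (L_op \<alpha> v) z"
  show "c *\<^sub>C ?R f \<in> L_dom"
    by (intro L_dom_scaleC resolvent_in_L_dom)
  have "snd (L_op \<alpha> v) (c *\<^sub>C ?R f) - z *\<^sub>C c *\<^sub>C ?R f
      = c *\<^sub>C (snd (L_op \<alpha> v) (?R f) - z *\<^sub>C ?R f)"
    by (simp add: L_op_scaleC resolvent_in_L_dom scaleC_diff_right scaleC_scaleC mult.commute)
  then show "snd (L_op \<alpha> v) (c *\<^sub>C ?R f) - z *\<^sub>C c *\<^sub>C ?R f = c *\<^sub>C f"
    by (simp only: resolvent_right_inverse)
qed

text \<open>The bound is the lower estimate in \<open>resolvent_set\<close>, read at the preimage of
  \<open>f\<close>. Boundedness is what lets the resolvent be applied to a series term by
  term.\<close>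

lemma bounded_linear_resolvent: "bounded_linear (resolvent (L_op \<alpha> v) z)"
proof -
  obtain C where C: "\<And>y. y \<in> L_dom \<Longrightarrow> norm y \<le> C * norm (snd (L_op \<alpha> v) y - z *\<^sub>C y)"
    using z by (auto simp: spectrum_def resolvent_set_def)
  show ?thesis
  proof (rule bounded_linear_intro)
    show "norm (resolvent (L_op \<alpha> v) z f) \<le> norm f * C" for f
      using C[OF resolvent_in_L_dom[of f]] by (simp add: resolvent_right_inverse mult.commute)
  qed (simp_all add: resolvent_add resolvent_scaleC scaleR_eq_scaleC)
qed

end

section \<open>Series for the unperturbed resolvent\<close>

lemma eigfun_nonzero: "eigfun n \<noteq> 0"
  using cinner_eigfun[of n n] by auto

text \<open>At an eigenvalue the eigenfunction would solve the homogeneous equation, contradicting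
  injectivity.\<close>

lemma eigval_neq:
  assumes z: "z \<notin> spectrum (L_op 0 v)"
  shows "eigval n - z \<noteq> 0"
proof
  assume "eigval n - z = 0"
  then have "resolvent (L_op 0 v) z 0 = eigfun n"
    by (intro resolvent_eqI[OF z]) (simp_all add: eigfun_in_L_dom L_op_0_eigfun flip: scaleC_diff_left)
  moreover have "resolvent (L_op 0 v) z 0 = 0"
    using resolvent_scaleC[OF z, of 0 0] by simp
  ultimately show False using eigfun_nonzero by metis
qed

lemma resolvent_L_op_0_eigfun:
  assumes z: "z \<notin> spectrum (L_op 0 v)"
  shows "resolvent (L_op 0 v) z (eigfun n) = (1 / (eigval n - z)) *\<^sub>C eigfun n"
proof (rule resolvent_eqI[OF z])
  define r where "r = 1 / (eigval n - z)"
  show "r *\<^sub>C eigfun n \<in> L_dom"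
    by (intro L_dom_scaleC eigfun_in_L_dom)
  have "r * eigval n - z * r = 1"
    using eigval_neq[OF z, of n] by (simp add: r_def divide_simps mult.commute)
  moreover have "snd (L_op 0 v) (r *\<^sub>C eigfun n) - z *\<^sub>C r *\<^sub>C eigfun n
      = (r * eigval n - z * r) *\<^sub>C eigfun n"
    by (simp add: L_op_scaleC eigfun_in_L_dom L_op_0_eigfun scaleC_scaleC scaleC_diff_left)
  ultimately show "snd (L_op 0 v) (r *\<^sub>C eigfun n) - z *\<^sub>C r *\<^sub>C eigfun n = eigfun n"
    by simp
qed

lemma resolvent_L_op_0_has_sum:
  assumes z: "z \<notin> spectrum (L_op 0 v)"
  shows "((\<lambda>n. (fourier_coeff f n / (eigval n - z)) *\<^sub>C eigfun n) has_sum resolvent (L_op 0 v) z f) UNIV"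
  using has_sum_bounded_linear[OF bounded_linear_resolvent[OF z]
      has_fourier_series_l2[of f, unfolded has_fourier_series_def]]
  by (simp add: resolvent_scaleC[OF z] resolvent_L_op_0_eigfun[OF z] scaleC_scaleC)

lemma cinner_resolvent_L_op_0_has_sum:
  assumes z: "z \<notin> spectrum (L_op 0 v)"
  shows "((\<lambda>n. fourier_coeff f n * cnj (fourier_coeff g n) / (eigval n - z))
    has_sum \<langle>resolvent (L_op 0 v) z f, g\<rangle>) UNIV"
proof -
  have "\<langle>eigfun n, g\<rangle> = cnj (fourier_coeff g n)" for n
    by (subst cinner_commute) (simp add: fourier_coeff_def)
  then show ?thesis
    using has_sum_bounded_linear[OF bounded_linear_cinner[of g] resolvent_L_op_0_has_sum[OF z, of f]]
    by (simp add: cinner_scaleC_left)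
qed

section \<open>The rank-one perturbation\<close>

lemma rank_one_perturbation:
  fixes \<alpha> :: real
  assumes z0: "z \<notin> spectrum (L_op 0 v)" and z: "z \<notin> spectrum (L_op \<alpha> v)"
  defines "R \<equiv> resolvent (L_op 0 v) z"
  shows "1 + \<alpha> * \<langle>R v, v\<rangle> \<noteq> 0"
    and "resolvent (L_op \<alpha> v) z f = R f - (\<alpha> * (\<langle>R f, v\<rangle> / (1 + \<alpha> * \<langle>R v, v\<rangle>))) *\<^sub>C R v"
proof -
  have R_dom: "R g \<in> L_dom" and R: "snd (L_op 0 v) (R g) - z *\<^sub>C R g = g" for g
    unfolding R_def using resolvent_in_L_dom[OF z0] resolvent_right_inverse[OF z0] by blast+
  have shift: "snd (L_op \<alpha> v) (R g) - z *\<^sub>C R g = g + (\<alpha> * \<langle>R g, v\<rangle>) *\<^sub>C v" for g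
  proof -
    have "snd (L_op \<alpha> v) (R g) - z *\<^sub>C R g
        = (snd (L_op 0 v) (R g) - z *\<^sub>C R g) + (\<alpha> * \<langle>R g, v\<rangle>) *\<^sub>C v"
      by (subst L_op_eq_L_op_0) simp
    then show ?thesis by (simp only: R)
  qed
  show nz: "1 + \<alpha> * \<langle>R v, v\<rangle> \<noteq> 0"
  proof
    assume 0: "1 + \<alpha> * \<langle>R v, v\<rangle> = 0"
    have "v + (\<alpha> * \<langle>R v, v\<rangle>) *\<^sub>C v = (1 + \<alpha> * \<langle>R v, v\<rangle>) *\<^sub>C v"
      by (simp add: scaleC_add_left)
    then have "resolvent (L_op \<alpha> v) z 0 = R v"
      using 0 by (intro resolvent_eqI[OF z] R_dom) (simp add: shift)
    moreover have "resolvent (L_op \<alpha> v) z 0 = 0"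
      using resolvent_scaleC[OF z, of 0 0] by simp
    \<comment> \<open>Now \<open>R v = 0\<close>, so the supposedly vanishing coefficient equals
      1.\<close>
    ultimately show False using 0 by simp
  qed
  \<comment> \<open>Try \<open>R (f - c v)\<close> as the solution. By \<open>shift\<close>, the
    perturbed operator minus \<open>z\<close> gives \<open>f\<close> plus the multiple
    \<open>\<alpha> * (\<langle>R f, v\<rangle> - c * \<langle>R v, v\<rangle>) - c\<close> of
    \<open>v\<close>; this \<open>c\<close> makes the multiple zero.\<close>
  define c where "c = \<alpha> * (\<langle>R f, v\<rangle> / (1 + \<alpha> * \<langle>R v, v\<rangle>))"
  have R_linear: "R f - c *\<^sub>C R v = R (f + (- c) *\<^sub>C v)"
    unfolding R_def resolvent_add[OF z0] resolvent_scaleC[OF z0] by (simp add: scaleC_minus_left)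
  have "\<langle>R (f + (- c) *\<^sub>C v), v\<rangle> = \<langle>R f, v\<rangle> - c * \<langle>R v, v\<rangle>"
    by (simp flip: R_linear add: cinner_diff_left cinner_scaleC_left)
  moreover have "\<alpha> * (\<langle>R f, v\<rangle> - c * \<langle>R v, v\<rangle>) = c"
    using nz by (simp add: c_def field_simps)
  ultimately have "f + (- c) *\<^sub>C v + (\<alpha> * \<langle>R (f + (- c) *\<^sub>C v), v\<rangle>) *\<^sub>C v = f"
    by (simp add: scaleC_minus_left)
  then have "resolvent (L_op \<alpha> v) z f = R f - c *\<^sub>C R v"
    unfolding R_linear by (intro resolvent_eqI[OF z] R_dom) (simp only: shift)
  then show "resolvent (L_op \<alpha> v) z f = R f - (\<alpha> * (\<langle>R f, v\<rangle> / (1 + \<alpha> * \<langle>R v, v\<rangle>))) *\<^sub>C R v"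
    by (simp only: c_def)
qed

text \<open>In HOL division by zero and the infinite sum of a non-summable family both yield 0. The
  nonzero denominators and the convergence of every series are therefore asserted along with the
  formulas.\<close>

theorem lemma4p1:
  fixes \<alpha> :: real and v :: l2 and z :: complex
  assumes "z \<notin> spectrum (L_op 0 v) \<union> spectrum (L_op \<alpha> v)"
  shows
    "(\<forall>n. eigval n - z \<noteq> 0) \<and>
     1 + \<alpha> * \<langle>resolvent (L_op 0 v) z v, v\<rangle> \<noteq> 0 \<and>
     (\<lambda>k. (cmod (fourier_coeff v k))\<^sup>2 / (eigval k - z)) summable_on UNIV \<and>
     1 + \<alpha> * (\<Sum>\<^sub>\<infinity>k. (cmod (fourier_coeff v k))\<^sup>2 / (eigval k - z)) \<noteq> 0 \<and>
     (\<lambda>n. (fourier_coeff v n / (eigval n - z)) *\<^sub>C eigfun n) summable_on UNIV \<and>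
     (\<forall>f.
        resolvent (L_op \<alpha> v) z f =
          resolvent (L_op 0 v) z f -
          (\<alpha> * (\<langle>resolvent (L_op 0 v) z f, v\<rangle> / (1 + \<alpha> * \<langle>resolvent (L_op 0 v) z v, v\<rangle>)))
            *\<^sub>C resolvent (L_op 0 v) z v \<and>
        (\<lambda>n. (fourier_coeff f n / (eigval n - z)) *\<^sub>C eigfun n) summable_on UNIV \<and>
        (\<lambda>k. fourier_coeff f k * cnj (fourier_coeff v k) / (eigval k - z)) summable_on UNIV \<and>
        resolvent (L_op \<alpha> v) z f =
          (\<Sum>\<^sub>\<infinity>n. (fourier_coeff f n / (eigval n - z)) *\<^sub>C eigfun n) -
          (\<alpha> * ((\<Sum>\<^sub>\<infinity>k. fourier_coeff f k * cnj (fourier_coeff v k) / (eigval k - z)) /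
                (1 + \<alpha> * (\<Sum>\<^sub>\<infinity>k. (cmod (fourier_coeff v k))\<^sup>2 / (eigval k - z)))))
            *\<^sub>C (\<Sum>\<^sub>\<infinity>n. (fourier_coeff v n / (eigval n - z)) *\<^sub>C eigfun n))"
proof -
  have z0: "z \<notin> spectrum (L_op 0 v)" and z: "z \<notin> spectrum (L_op \<alpha> v)"
    using assms by auto
  note series = resolvent_L_op_0_has_sum[OF z0] cinner_resolvent_L_op_0_has_sum[OF z0]
  \<comment> \<open>The denominator series is the case \<open>f = g = v\<close> of the pairing, with
    \<open>v_k\<close> times its conjugate rewritten as a squared modulus.\<close>
  have v_series: "((\<lambda>k. complex_of_real ((cmod (fourier_coeff v k))\<^sup>2) / (eigval k - z))
      has_sum \<langle>resolvent (L_op 0 v) z v, v\<rangle>) UNIV"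
    using series(2)[of v v] by (simp only: complex_norm_square)
  note sums = series[THEN infsumI] v_series[THEN infsumI]
  note summable = series[THEN has_sum_imp_summable] v_series[THEN has_sum_imp_summable]
  show ?thesis
    \<comment> \<open>Replacing each infinite sum by its value turns the series formula into the
      operator formula, and the two nonvanishing claims coincide.\<close>
    unfolding sums
    by (intro conjI allI eigval_neq[OF z0] rank_one_perturbation[OF z0 z] summable)
qed

end
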